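(* There exist $\tilde p<1$ and $\kappa>0$ such that, for every $p$ with $\tilde p\le p<1$, every $c\ge2$, every box $\Lambda$ with $\ln|\Lambda|>4+c+2dc^2+12(2\kappa d)^d$, and every edge $e\subset\Lambda$ with $d(e,\Lambda^c)\ge\kappa c^2\ln^2|\Lambda|$, $$\mu_p\Big(e\in\mathcal I\ \Big|\ \exists C\in\mathcal C,\ d(e,C)\ge\kappa c^2\ln^2|\Lambda|\Big)\le\frac1{|\Lambda|^c}.$$
   Context: Fix an integer $d\ge 2$. $\mathbb E^d$ is the set of pairs $\{x,y\}$ of points of $\mathbb Z^d$ at Euclidean distance $1$; an edge is identified with the corresponding closed unit segment. $\Lambda$ is a closed cubic box of positive side length in $\mathbb R^d$, centred at the origin, with sides parallel to the axes and corners in $\mathbb Z^d$; $|\Lambda|$ is the cardinality of $\Lambda\cap\mathbb Z^d$; $\Lambda^c=\mathbb R^d\setminus\Lambda$; $T$ and $B$ are the top and bottom sides (faces) of $\Lambda$. A configuration is a map $\omega$ from the set of edges included in $\Lambda$ to $\{0,1\}$; $e$ is open if $\omega(e)=1$, closed if $\omega(e)=0$. $T\overset{\omega}{\longleftrightarrow}B$ means that a path of open edges joins a vertex of $T$ to a vertex of $B$. $\omega^e$ is the configuration obtained from $\omega$ by opening $e$. Coupling. Let $0<p<1$. Let $(E_t)_{t\ge1}$ be i.i.d. uniform on the edges included in $\Lambda$ and $(B_t)_{t\ge1}$ i.i.d. Bernoulli($p$), all independent of each other and of $(X_0,Y_0)$. For $t\ge1$: $X_t(e)=X_{t-1}(e)$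 and $Y_t(e)=Y_{t-1}(e)$ for $e\ne E_t$; $X_t(E_t)=B_t$; $Y_t(E_t)=1$ if $B_t=1$ and $T$ is not connected to $B$ in $Y_{t-1}^{E_t}$, and $Y_t(E_t)=0$ otherwise. This Markov chain, on the set of pairs $(\omega_1,\omega_2)$ with $\omega_1\ge\omega_2$ edgewise and $T$ not connected to $B$ in $\omega_2$, has a unique equilibrium distribution, denoted $\mu_p$; let $(X,Y)$ have law $\mu_p$. $\mathcal I=\{e\subset\Lambda:X(e)\ne Y(e)\}$ is the interface. A set $S$ of edges of $\Lambda$ separates $T$ and $B$ if every path of edges from $T$ to $B$ in $\Lambda$ intersects $S$; a cut is a separating set that is minimal for inclusion. A cut is closed in $Y$ if all its edges are closed in $Y$; $\mathcal C$ is the collection of the cuts closed in $Y$. $d(\cdot,\cdot)$ is Euclidean distance (between sets, the infimum), a set of edges being viewed as the union of its segments; $d$ alone is the dimension. The conditional inequality is understood when the conditioning event has positive probability. The constants depend only on $d$. *)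

theory Defs
  imports "HOL-Probability.Probability"
begin

text \<open>
  The dimension is \<^term>\<open>CARD('d)\<close>, for a finite index type \<^typ>\<open>'d\<close>.
\<close>

definition lattice :: "(real^'d) set" where
  "lattice = {x. \<forall>i. x $ i \<in> \<int>}"

definition lattice_edges :: "(real^'d) set set" where
  "lattice_edges = {{x, y} | x y. x \<in> lattice \<and> y \<in> lattice \<and> dist x y = 1}"

text \<open>The closed segment of an edge \<open>{x, y}\<close>.\<close>

definition segment :: "(real^'d) set \<Rightarrow> (real^'d) set" where
  "segment e = convex hull e"

definition support :: "(real^'d) set set \<Rightarrow> (real^'d) set" where
  "support S = (\<Union>e\<in>S. segment e)"

text \<open>
  A closed cube centred at the origin, with sides parallel to the axes, has its corners in
  the integer lattice iff half its side length is an integer. So the admissible boxes are the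
  sets \<open>cube n\<close> with \<open>n \<ge> 1\<close>.
\<close>

definition cube :: "nat \<Rightarrow> (real^'d) set" where
  "cube n = cbox (\<chi> i. - real n) (\<chi> i. real n)"

definition cube_size :: "'d::finite itself \<Rightarrow> nat \<Rightarrow> nat" where
  "cube_size _ n = card (cube n \<inter> (lattice :: (real^'d) set))"

definition edges :: "nat \<Rightarrow> (real^'d) set set" where
  "edges n = {e \<in> lattice_edges. segment e \<subseteq> cube n}"

text \<open>The argument \<open>v\<close> is the coordinate taken as the vertical one.\<close>

definition top_face :: "'d::finite \<Rightarrow> nat \<Rightarrow> (real^'d) set" where
  "top_face v n = {x \<in> cube n. x $ v = real n}"

definition bottom_face :: "'d::finite \<Rightarrow> nat \<Rightarrow> (real^'d) set" where
  "bottom_face v n = {x \<in> cube n. x $ v = - real n}"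

text \<open>
  A path is given by the list of its successive vertices, which may repeat. Allowing repetitions
  changes neither connectedness nor separation, since every such path contains a
  self-avoiding one with the same endpoints.
\<close>

definition path_edges :: "(real^'d) list \<Rightarrow> (real^'d) set set" where
  "path_edges xs = {{xs ! i, xs ! Suc i} | i. Suc i < length xs}"

definition top_bottom_path :: "'d::finite \<Rightarrow> nat \<Rightarrow> (real^'d) list \<Rightarrow> bool" where
  "top_bottom_path v n xs \<longleftrightarrow> xs \<noteq> [] \<and> path_edges xs \<subseteq> edges n
     \<and> hd xs \<in> top_face v n \<inter> lattice \<and> last xs \<in> bottom_face v n \<inter> lattice"

text \<open>
  A configuration is a map from the edges included in the box to \<^typ>\<open>bool\<close>
  (\<open>True\<close> for 1, that is open), with the value \<open>undefined\<close> elsewhere.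
\<close>

type_synonym 'd config = "(real^'d) set \<Rightarrow> bool"

definition configs :: "nat \<Rightarrow> 'd::finite config set" where
  "configs n = edges n \<rightarrow>\<^sub>E UNIV"

definition connected_in :: "'d::finite \<Rightarrow> nat \<Rightarrow> 'd config \<Rightarrow> bool" where
  "connected_in v n w \<longleftrightarrow> (\<exists>xs. top_bottom_path v n xs \<and> (\<forall>e\<in>path_edges xs. w e))"

definition open_edge :: "(real^'d) set \<Rightarrow> 'd::finite config \<Rightarrow> 'd config" where
  "open_edge e w = w(e := True)"

definition states :: "'d::finite \<Rightarrow> nat \<Rightarrow> ('d config \<times> 'd config) set" where
  "states v n = {(x, y). x \<in> configs n \<and> y \<in> configs n
     \<and> (\<forall>e\<in>edges n. y e \<le> x e) \<and> \<not> connected_in v n y}"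

definition update ::
  "'d::finite \<Rightarrow> nat \<Rightarrow> (real^'d) set \<Rightarrow> bool \<Rightarrow> 'd config \<times> 'd config \<Rightarrow> 'd config \<times> 'd config" where
  "update v n e b = (\<lambda>(x, y).
     (x(e := b), y(e := (b \<and> \<not> connected_in v n (open_edge e y)))))"

text \<open>The transition kernel of the coupled chain.\<close>

definition kernel ::
  "'d::finite \<Rightarrow> nat \<Rightarrow> real \<Rightarrow> 'd config \<times> 'd config \<Rightarrow> ('d config \<times> 'd config) pmf" where
  "kernel v n p s =
     map_pmf (\<lambda>(e, b). update v n e b s) (pair_pmf (pmf_of_set (edges n)) (bernoulli_pmf p))"

text \<open>
  For \<open>n \<ge> 1\<close> and \<open>0 < p < 1\<close> the chain is finite and the pair of all-closed configurations
  is accessible from every state, so exactly one \<open>\<mu>\<close> satisfies the following.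
\<close>

definition equilibrium ::
  "'d::finite \<Rightarrow> nat \<Rightarrow> real \<Rightarrow> ('d config \<times> 'd config) pmf \<Rightarrow> bool" where
  "equilibrium v n p \<mu> \<longleftrightarrow> set_pmf \<mu> \<subseteq> states v n \<and> bind_pmf \<mu> (kernel v n p) = \<mu>"

definition "interface" :: "nat \<Rightarrow> 'd::finite config \<Rightarrow> 'd config \<Rightarrow> (real^'d) set set" where
  "interface n x y = {e \<in> edges n. x e \<noteq> y e}"

definition separates :: "'d::finite \<Rightarrow> nat \<Rightarrow> (real^'d) set set \<Rightarrow> bool" where
  "separates v n S \<longleftrightarrow> S \<subseteq> edges n
     \<and> (\<forall>xs. top_bottom_path v n xs \<longrightarrow> path_edges xs \<inter> S \<noteq> {})"

definition is_cut :: "'d::finite \<Rightarrow> nat \<Rightarrow> (real^'d) set set \<Rightarrow> bool" where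
  "is_cut v n S \<longleftrightarrow> separates v n S \<and> (\<forall>S'. S' \<subset> S \<longrightarrow> \<not> separates v n S')"

definition closed_cuts :: "'d::finite \<Rightarrow> nat \<Rightarrow> 'd config \<Rightarrow> (real^'d) set set set" where
  "closed_cuts v n y = {C. is_cut v n C \<and> (\<forall>e\<in>C. \<not> y e)}"

end

theory Submission
  imports Defs "HOL-Library.Transitive_Closure_Table"
begin

text \<open>
  Fix the edge \<open>e\<close>, and call an edge nearby if its distance to \<open>e\<close> is less than \<open>r\<close>. Some closed
  cut stays at distance at least \<open>r\<close> from \<open>e\<close> if and only if top and bottom remain disconnected after
  all nearby edges have been opened (\<open>far_cut_iff\<close>). This event \<open>A\<close> ignores the state of the nearby
  edges. At equilibrium \<open>Y\<close> is Bernoulli percolation conditioned on disconnection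
  (\<open>stationary_unique\<close>), and \<open>A\<close> implies disconnection. Hence, conditionally on \<open>A\<close>, the nearby edges
  of \<open>Y\<close> are independent and open with probability \<open>p\<close>.

  If \<open>e\<close> is in the interface, then at its last update the coin was 1 and the opening was refused, so
  that \<open>e\<close> was closed and pivotal for \<open>Y\<close>. This update is one of the last \<open>K * card E\<close> steps, up to
  probability \<open>exp (- K)\<close>. The dynamics of \<open>Y\<close> is reversible, so time can be reversed
  (\<open>disagreement_bound\<close>): it suffices to start \<open>Y\<close> from its law conditioned on \<open>A\<close> and to show that \<open>e\<close>
  is very unlikely to be pivotal at any given one of the next \<open>K * card E\<close> steps.

  Use the same noise to run on the nearby edges the free dynamics, in which no opening is refused. It
  is stationary. A pivotal edge lies on a closed minimal cut. Minimal cuts are connected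
  (\<open>cut_near_connected\<close>), and a cut cannot consist of nearby edges only, because it meets every
  vertical edge of the box; so a path of closed edges leads from a pivotal nearby edge to an edge that
  is not nearby. Every nearby edge of this path which is open in the free dynamics was refused an
  opening earlier, when it was pivotal itself, and from there one follows another such path, at an
  earlier time. Thus a pivotal \<open>e\<close> is joined to the complement of the nearby edges by a path in space
  and time made of edges closed in the free dynamics (\<open>pivotal_trace\<close>). Divide time into \<open>K\<close> blocks
  of \<open>card E\<close> steps. If \<open>r > 2 * l * K\<close>, then for one of the blocks there is a path of \<open>l\<close> distinct
  neighbouring edges each of which is closed in the free dynamics at some time of the block. Within a
  block an edge is updated about once, so a given path has this property with probability at most
  \<open>(2 * (1 - p)) ^ l\<close>, and there are at most \<open>card E * D ^ l\<close> paths, where \<open>D\<close> bounds the number of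
  neighbours. For \<open>p\<close> close to 1 the bound \<open>1 / N powr c\<close> follows with both \<open>K\<close> and \<open>l\<close> of order
  \<open>c * ln N\<close>, whence the distance of order \<open>c\<^sup>2 * (ln N)\<^sup>2\<close>.
\<close>

section \<open>Heat bath dynamics conditioned on a decreasing event\<close>

text \<open>
  The probabilistic part of the argument sees the lattice only through the finite set \<open>E\<close> of edges
  and the increasing event \<open>conn\<close> that top and bottom are connected.
\<close>

locale conditioned_dynamics =
  fixes E :: "'e set" and conn :: "('e \<Rightarrow> bool) \<Rightarrow> bool" and p :: real
  assumes finite_E: "finite E" and nonempty_E: "E \<noteq> {}"
    and p_pos: "0 < p" and p_less: "p < 1"
    and conn_mono: "conn x \<Longrightarrow> (\<And>e. e \<in> E \<Longrightarrow> x e \<Longrightarrow> y e) \<Longrightarrow> conn y"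
begin

definition step :: "'e \<times> bool \<Rightarrow> ('e \<Rightarrow> bool) \<Rightarrow> 'e \<Rightarrow> bool" where
  "step = (\<lambda>(f, b) y. y(f := (b \<and> \<not> conn (y(f := True)))))"

definition noise :: "('e \<times> bool) pmf" where
  "noise = pair_pmf (pmf_of_set E) (bernoulli_pmf p)"

definition percolation :: "('e \<Rightarrow> bool) pmf" where
  "percolation = Pi_pmf E undefined (\<lambda>_. bernoulli_pmf p)"

text \<open>
  The expectation of \<open>g\<close> after one step, on the event that the updated edge lies in \<open>S\<close>. For \<open>S = E\<close>
  this is the transition operator of the dynamics; for \<open>S = E - {e}\<close> it is the part of the operator
  that leaves \<open>e\<close> alone.
\<close>

definition avg :: "'e set \<Rightarrow> (('e \<Rightarrow> bool) \<Rightarrow> ennreal) \<Rightarrow> ('e \<Rightarrow> bool) \<Rightarrow> ennreal" where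
  "avg S g y = (\<Sum>f\<in>S. ennreal p * g (step (f, True) y) + ennreal (1 - p) * g (step (f, False) y))
     / of_nat (card E)"

text \<open>
  Up to normalisation, the scalar product for the law of percolation conditioned on \<open>\<not> conn\<close>.
\<close>

definition inner_prod :: "(('e \<Rightarrow> bool) \<Rightarrow> ennreal) \<Rightarrow> (('e \<Rightarrow> bool) \<Rightarrow> ennreal) \<Rightarrow> ennreal" where
  "inner_prod h g = (\<integral>\<^sup>+w. (if conn w then 0 else h w * g w) \<partial>percolation)"

lemma nn_integral_noise:
  "(\<integral>\<^sup>+z. F z \<partial>noise)
    = (\<Sum>f\<in>E. ennreal p * F (f, True) + ennreal (1 - p) * F (f, False)) / of_nat (card E)"
  using p_pos p_less finite_E nonempty_E
  by (simp add: noise_def nn_integral_pair_pmf' nn_integral_pmf_of_set mult.commute ennreal_of_nat_eq_real_of_nat)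

text \<open>
  Redrawing one coordinate preserves a product measure. Integrals against percolation are always
  handled through this identity.
\<close>

lemma percolation_resample:
  assumes "f \<in> E"
  shows "(\<integral>\<^sup>+w. F w \<partial>percolation)
    = (\<integral>\<^sup>+w. ennreal p * F (w(f := True)) + ennreal (1 - p) * F (w(f := False)) \<partial>percolation)"
proof -
  have "percolation = map_pmf (\<lambda>(b, w). w(f := b))
      (pair_pmf (bernoulli_pmf p) (Pi_pmf (E - {f}) undefined (\<lambda>_. bernoulli_pmf p)))"
    using Pi_pmf_insert[of "E - {f}" f undefined "\<lambda>_. bernoulli_pmf p"] assms finite_E
    by (simp add: percolation_def insert_absorb)
  then show ?thesis
    using p_pos p_less
    by (simp add: nn_integral_pair_pmf' nn_integral_add nn_integral_cmult mult.commute
          flip: distrib_left ennreal_plus)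
qed

text \<open>
  Detailed balance. Once \<open>f\<close> is resampled, only the two configurations that differ at \<open>f\<close> matter. If
  both are blocked, the update redraws \<open>f\<close> whatever its current state; if only the one with \<open>f\<close>
  closed is, the update does not change it. Both cases are symmetric in \<open>g\<close> and \<open>h\<close>.
\<close>

lemma step_self_adjoint:
  assumes "f \<in> E"
  shows "inner_prod h (\<lambda>w. ennreal p * g (step (f, True) w) + ennreal (1 - p) * g (step (f, False) w))
    = inner_prod g (\<lambda>w. ennreal p * h (step (f, True) w) + ennreal (1 - p) * h (step (f, False) w))"
proof -
  have "conn (w(f := True))" if "conn (w(f := False))" for w
    using that by (rule conn_mono) (auto split: if_splits)
  then show ?thesis
    unfolding inner_prod_def
    by (subst (1 2) percolation_resample[OF assms], intro nn_integral_cong)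
       (auto simp: step_def algebra_simps)
qed

lemma inner_prod_commute: "inner_prod h g = inner_prod g h"
  by (auto simp: inner_prod_def mult.commute intro!: nn_integral_cong)

lemma avg_self_adjoint:
  assumes "S \<subseteq> E"
  shows "inner_prod h (avg S g) = inner_prod (avg S h) g"
proof -
  have *: "inner_prod h (avg S g)
      = (\<Sum>f\<in>S. inner_prod h (\<lambda>w. ennreal p * g (step (f, True) w) + ennreal (1 - p) * g (step (f, False) w)))
          / of_nat (card E)" for h g
    unfolding inner_prod_def avg_def divide_ennreal_def
    by (subst nn_integral_sum[symmetric], simp, subst nn_integral_multc[symmetric], simp)
       (auto intro!: nn_integral_cong simp: sum_distrib_left mult_ac)
  have "inner_prod h (avg S g) = inner_prod g (avg S h)"
    unfolding * using step_self_adjoint assms by (auto intro!: sum.cong arg_cong2[where f="(/)"])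
  then show ?thesis
    by (simp add: inner_prod_commute)
qed

lemma avg_power_self_adjoint:
  assumes "S \<subseteq> E"
  shows "inner_prod h ((avg S ^^ j) g) = inner_prod ((avg S ^^ j) h) g"
  by (induction j arbitrary: h g) (simp_all add: avg_self_adjoint[OF assms] funpow_swap1)

lemma avg_mono: "(\<And>w. g w \<le> h w) \<Longrightarrow> S \<subseteq> S' \<Longrightarrow> S' \<subseteq> E \<Longrightarrow> avg S g y \<le> avg S' h y"
  unfolding avg_def
  by (intro divide_right_mono_ennreal order.trans[OF sum_mono sum_mono2])
     (auto intro!: add_mono mult_left_mono finite_subset[OF _ finite_E])

lemma avg_power_mono: "(\<And>w. g w \<le> h w) \<Longrightarrow> S \<subseteq> S' \<Longrightarrow> S' \<subseteq> E \<Longrightarrow> (avg S ^^ j) g y \<le> (avg S' ^^ j) h y"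
  by (induction j arbitrary: y) (auto intro!: avg_mono)

lemma avg_E: "avg E g y = (\<integral>\<^sup>+z. g (step z y) \<partial>noise)"
  by (simp add: nn_integral_noise avg_def)

lemma bernoulli_mix_const: "ennreal p * a + ennreal (1 - p) * a = a"
  using p_pos p_less by (simp add: distrib_right[symmetric] ennreal_plus[symmetric] del: ennreal_plus)

lemma avg_const: "avg S (\<lambda>_. a) y = ennreal (card S / card E) * a"
  unfolding avg_def bernoulli_mix_const using finite_E nonempty_E
  by (simp add: divide_ennreal[symmetric] card_gt_0_iff
        ennreal_of_nat_eq_real_of_nat ennreal_times_divide mult.commute)

definition run :: "('e \<times> bool) list \<Rightarrow> ('e \<Rightarrow> bool) \<Rightarrow> 'e \<Rightarrow> bool" where
  "run ns = fold step ns"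

lemma avg_E_power: "(avg E ^^ j) g y = (\<integral>\<^sup>+ns. g (run ns y) \<partial>replicate_pmf j noise)"
  by (induction j arbitrary: y) (simp_all add: run_def avg_E)



definition blocked_configs :: "('e \<Rightarrow> bool) set" where
  "blocked_configs = {y \<in> E \<rightarrow>\<^sub>E UNIV. \<not> conn y}"

lemma finite_blocked_configs: "finite blocked_configs"
  unfolding blocked_configs_def using finite_E by (intro finite_subset[OF _ finite_PiE]) auto

lemma conn_close: "\<not> conn y \<Longrightarrow> \<not> conn (y(f := False))"
  by (erule contrapos_nn, erule conn_mono) (auto split: if_splits)

lemma step_blocked_configs:
  assumes "y \<in> blocked_configs" "fst z \<in> E"
  shows "step z y \<in> blocked_configs"
  using assms conn_close[of y "fst z"]
  by (cases z; cases "snd z \<and> \<not> conn (y(fst z := True))")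
     (auto simp: blocked_configs_def step_def PiE_iff extensional_def)

text \<open>
  The equation that reversibility imposes on the density of a stationary law with respect to
  percolation; both sides are multiplied by \<open>card E\<close>.
\<close>

definition harmonic :: "(('e \<Rightarrow> bool) \<Rightarrow> real) \<Rightarrow> bool" where
  "harmonic h \<longleftrightarrow> (\<forall>y\<in>blocked_configs.
     h y * card E = (\<Sum>f\<in>E. p * h (step (f, True) y) + (1 - p) * h (step (f, False) y)))"

abbreviation all_closed :: "'e \<Rightarrow> bool" where
  "all_closed \<equiv> (\<lambda>e. if e \<in> E then False else undefined)"

text \<open>
  A maximum principle: where \<open>h\<close> is maximal, it equals an average of values that do not exceed the
  maximum, so it is also maximal at every configuration reached by one step. Closing an edge is always
  possible in one step, and closing all edges leads to \<open>all_closed\<close>.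
\<close>

lemma harmonic_le_all_closed:
  assumes h: "harmonic h" and y: "y \<in> blocked_configs"
  shows "h y \<le> h all_closed"
proof -
  define M where "M = Max (h ` blocked_configs)"
  have le_M: "h x \<le> M" if "x \<in> blocked_configs" for x
    using that finite_blocked_configs by (simp add: M_def)
  have "M \<in> h ` blocked_configs"
    unfolding M_def using y finite_blocked_configs by (intro Max_in) auto
  then obtain y0 where y0: "y0 \<in> blocked_configs" "h y0 = M"
    by auto
  have close: "x(f := False) \<in> blocked_configs \<and> h (x(f := False)) = M"
    if x: "x \<in> blocked_configs" "h x = M" and f: "f \<in> E" for x f
  proof -
    have le: "h (step (g, b) x) \<le> M" if "g \<in> E" for g b
      by (rule le_M, rule step_blocked_configs) (use that x in auto)
    have nonneg: "0 \<le> p * (M - h (step (g, True) x)) + (1 - p) * (M - h (step (g, False) x))"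
      if "g \<in> E" for g
      using le[OF that] p_pos p_less by simp
    have "(\<Sum>g\<in>E. p * (M - h (step (g, True) x)) + (1 - p) * (M - h (step (g, False) x)))
        = (\<Sum>g\<in>E. M - (p * h (step (g, True) x) + (1 - p) * h (step (g, False) x)))"
      by (intro sum.cong) (auto simp: algebra_simps)
    also have "\<dots> = 0"
      using h[unfolded harmonic_def, rule_format, OF x(1)] x(2) by (simp add: sum_subtractf mult.commute)
    finally have "p * (M - h (step (f, True) x)) + (1 - p) * (M - h (step (f, False) x)) = 0"
      using nonneg f by (subst (asm) sum_nonneg_eq_0_iff[OF finite_E]) blast+
    moreover have "0 \<le> p * (M - h (step (f, True) x))" "0 \<le> (1 - p) * (M - h (step (f, False) x))"
      using le[OF f] p_pos p_less by simp_all
    ultimately have "(1 - p) * (M - h (step (f, False) x)) = 0"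
      by linarith
    then show ?thesis
      using p_less step_blocked_configs[OF x(1), of "(f, False)"] f by (simp add: step_def)
  qed
  have close_all: "(\<lambda>e. if e \<in> S then False else y0 e) \<in> blocked_configs
      \<and> h (\<lambda>e. if e \<in> S then False else y0 e) = M" if "S \<subseteq> E" for S
    using finite_subset[OF that finite_E] that
  proof (induction S rule: finite_induct)
    case (insert f S)
    have eq: "(\<lambda>e. if e \<in> insert f S then False else y0 e) = (\<lambda>e. if e \<in> S then False else y0 e)(f := False)"
      by (rule ext) simp
    have "(\<lambda>e. if e \<in> S then False else y0 e) \<in> blocked_configs"
        "h (\<lambda>e. if e \<in> S then False else y0 e) = M" "f \<in> E"
      using insert by auto
    from close[OF this] show ?case
      unfolding eq .
  qed (use y0 in simp)
  have eq: "(\<lambda>e. if e \<in> E then False else y0 e) = all_closed"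
    using y0 by (auto simp: blocked_configs_def PiE_iff extensional_def)
  have "h all_closed = M"
    using close_all[OF order_refl] unfolding eq by blast
  then show ?thesis
    using le_M[OF y] by simp
qed

lemma harmonic_const:
  assumes "harmonic h" and y: "y \<in> blocked_configs"
  shows "h y = h all_closed"
proof -
  have "harmonic (\<lambda>y. - h y)"
    using assms(1) by (simp add: harmonic_def sum_negf[symmetric] sum_subtractf sum.distrib)
  from harmonic_le_all_closed[OF this y] harmonic_le_all_closed[OF assms] show ?thesis
    by simp
qed

lemma pmf_percolation_pos: "y \<in> E \<rightarrow>\<^sub>E UNIV \<Longrightarrow> 0 < pmf percolation y"
proof -
  assume y: "y \<in> E \<rightarrow>\<^sub>E UNIV"
  have "pmf percolation y = (\<Prod>x\<in>E. pmf (bernoulli_pmf p) (y x))"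
    unfolding percolation_def using finite_E y by (subst pmf_Pi') (auto simp: PiE_iff extensional_def)
  moreover have "0 < pmf (bernoulli_pmf p) b" for b
    using p_pos p_less by (cases b) simp_all
  ultimately show ?thesis
    by (simp add: prod_pos)
qed

text \<open>
  The density of \<open>\<nu>\<close> with respect to percolation is harmonic by self-adjointness, hence constant on the
  blocked configurations. So \<open>\<nu>\<close> is percolation conditioned on \<open>\<not> conn\<close>, with normalisation \<open>k\<close>.
\<close>

lemma stationary_unique:
  assumes supp: "set_pmf \<nu> \<subseteq> blocked_configs"
    and stationary: "\<And>g. (\<integral>\<^sup>+y. avg E g y \<partial>\<nu>) = (\<integral>\<^sup>+y. g y \<partial>\<nu>)"
  obtains k :: ennreal where "\<And>g. (\<integral>\<^sup>+y. g y \<partial>\<nu>) = inner_prod (\<lambda>_. k) g"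
proof -
  define h where "h y = pmf \<nu> y / pmf percolation y" for y
  have nu: "(\<integral>\<^sup>+y. g y \<partial>\<nu>) = inner_prod (\<lambda>y. ennreal (h y)) g" for g
    unfolding inner_prod_def nn_integral_measure_pmf
  proof (intro nn_integral_cong)
    fix y
    show "ennreal (pmf \<nu> y) * g y
        = ennreal (pmf percolation y) * (if conn y then 0 else ennreal (h y) * g y)"
    proof (cases "y \<in> blocked_configs")
      case True
      then have "ennreal (pmf \<nu> y) = ennreal (pmf percolation y) * ennreal (h y)"
        using pmf_percolation_pos[of y] by (simp add: h_def blocked_configs_def ennreal_mult[symmetric])
      with True show ?thesis
        by (simp only: blocked_configs_def mem_Collect_eq if_False mult.assoc simp_thms)
    next
      case False
      then have "pmf \<nu> y = 0"
        using supp by (auto simp: set_pmf_iff)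
      then show ?thesis
        by (simp add: h_def)
    qed
  qed
  have delta: "inner_prod a (indicator {y}) = a y * ennreal (pmf percolation y)" if "y \<in> blocked_configs" for a y
  proof -
    have "inner_prod a (indicator {y}) = (\<integral>\<^sup>+w. a y * indicator {y} w \<partial>percolation)"
      unfolding inner_prod_def using that
      by (intro nn_integral_cong) (auto simp: blocked_configs_def indicator_def)
    then show ?thesis
      by (simp add: nn_integral_cmult emeasure_pmf_single)
  qed
  have "harmonic h"
    unfolding harmonic_def
  proof
    fix y assume y: "y \<in> blocked_configs"
    have "inner_prod (avg E (\<lambda>y. ennreal (h y))) (indicator {y}) = inner_prod (\<lambda>y. ennreal (h y)) (indicator {y})"
      using stationary[of "indicator {y}"] by (simp add: nu avg_self_adjoint)
    then have harm: "avg E (\<lambda>y. ennreal (h y)) y = ennreal (h y)"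
      using pmf_percolation_pos[of y] y ennreal_mult_divide_eq[of "ennreal (pmf percolation y)"] unfolding delta[OF y]
      by (metis (no_types, lifting) blocked_configs_def ennreal_eq_0_iff ennreal_neq_top mem_Collect_eq not_le)
    have h0: "0 \<le> h x" for x
      by (simp add: h_def)
    have "ennreal p * ennreal a + ennreal (1 - p) * ennreal b = ennreal (p * a + (1 - p) * b)"
      if "0 \<le> a" "0 \<le> b" for a b
      using that p_pos p_less by (metis diff_ge_0_iff_ge ennreal_mult ennreal_plus less_imp_le mult_nonneg_nonneg)
    note weights = this
    define a where "a = (\<Sum>f\<in>E. p * h (step (f, True) y) + (1 - p) * h (step (f, False) y))"
    have "avg E (\<lambda>y. ennreal (h y)) y = ennreal a / ennreal (card E)"
      unfolding avg_def a_def using p_pos p_less h0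
      by (simp add: weights sum_ennreal ennreal_of_nat_eq_real_of_nat del: ennreal_plus)
    moreover have "0 \<le> a"
      unfolding a_def using h0 p_pos p_less by (intro sum_nonneg) simp
    ultimately have "ennreal (h y) = ennreal (a / card E)"
      using harm nonempty_E finite_E by (simp add: divide_ennreal card_gt_0_iff)
    then have "h y = a / card E"
      using h0[of y] \<open>0 \<le> a\<close> by (subst (asm) ennreal_inj) auto
    then show "h y * card E = (\<Sum>f\<in>E. p * h (step (f, True) y) + (1 - p) * h (step (f, False) y))"
      using nonempty_E finite_E by (simp add: a_def)
  qed
  then have h: "h y = h all_closed" if "y \<in> blocked_configs" for y
    using harmonic_const that by blast
  have "(\<integral>\<^sup>+y. g y \<partial>\<nu>) = inner_prod (\<lambda>_. ennreal (h all_closed)) g" for g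
    unfolding nu inner_prod_def
    by (intro nn_integral_cong_AE AE_pmfI)
       (use set_Pi_pmf_subset[OF finite_E, of undefined "\<lambda>_. bernoulli_pmf p"] h
         in \<open>auto simp: percolation_def blocked_configs_def PiE_iff extensional_def\<close>)
  then show thesis
    using that by blast
qed

lemma inner_prod_const: "inner_prod (\<lambda>_. a) g = a * inner_prod (\<lambda>_. 1) g"
  by (auto simp: inner_prod_def nn_integral_cmult[symmetric] intro!: nn_integral_cong)

text \<open>
  If another edge is chosen, the comparison at \<open>e\<close> does not change. If \<open>e\<close> is chosen, the two
  configurations differ at \<open>e\<close> afterwards only when its opening was refused; then \<open>e\<close> was pivotal and
  \<open>y\<close> has not moved.
\<close>

lemma one_update_disagreement:
  assumes y: "y \<in> blocked_configs" and e: "e \<in> E"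
  shows "(\<integral>\<^sup>+z. of_bool ((x(fst z := snd z)) e \<noteq> step z y e) * g (step z y) \<partial>noise)
    \<le> of_bool (x e \<noteq> y e) * avg (E - {e}) g y + of_bool (conn (y(e := True))) * g y / of_nat (card E)"
proof -
  let ?F = "\<lambda>z. of_bool ((x(fst z := snd z)) e \<noteq> step z y e) * g (step z y)"
  let ?D = "of_bool (x e \<noteq> y e) :: ennreal"
  have other: "ennreal p * ?F (f, True) + ennreal (1 - p) * ?F (f, False)
      = ?D * (ennreal p * g (step (f, True) y) + ennreal (1 - p) * g (step (f, False) y))"
    if "f \<noteq> e" for f
    using that by (simp add: step_def algebra_simps)
  have chosen: "ennreal p * ?F (e, True) + ennreal (1 - p) * ?F (e, False)
      \<le> of_bool (conn (y(e := True))) * g y"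
  proof (cases "conn (y(e := True))")
    case True
    then have "\<not> y e"
      using y fun_upd_idem[of y e True] by (auto simp: blocked_configs_def)
    then have "step (e, True) y = y"
      using True by (simp add: step_def fun_upd_idem)
    moreover have "ennreal p * g y \<le> 1 * g y"
      using p_less by (intro mult_right_mono) auto
    ultimately show ?thesis
      using True \<open>\<not> y e\<close> by (simp add: step_def)
  qed (simp add: step_def)
  have "(\<Sum>f\<in>E. ennreal p * ?F (f, True) + ennreal (1 - p) * ?F (f, False))
      \<le> of_bool (conn (y(e := True))) * g y + (\<Sum>f\<in>E - {e}.
          ?D * (ennreal p * g (step (f, True) y) + ennreal (1 - p) * g (step (f, False) y)))"
    unfolding sum.remove[OF finite_E e] by (rule add_mono[OF chosen], rule sum_mono, subst other) auto
  from divide_right_mono_ennreal[OF this, of "of_nat (card E)"] show ?thesis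
    unfolding nn_integral_noise avg_def sum_distrib_left[symmetric]
    by (simp add: divide_ennreal_def distrib_right mult.assoc add.commute)
qed

text \<open>
  Go back \<open>T\<close> steps from equilibrium. A disagreement at \<open>e\<close> was created at one of these steps, when \<open>e\<close>
  was pivotal, and \<open>e\<close> was not chosen since, or else \<open>e\<close> was never chosen. By self-adjointness the
  event \<open>A\<close>, observed at the end, may be moved to the beginning. The first possibility is then
  controlled by the hypothesis \<open>rare\<close>, and the second has probability \<open>(1 - 1 / card E) ^ T\<close> whatever
  the starting point.
\<close>

lemma disagreement_bound:
  fixes \<epsilon> :: ennreal
  assumes supp: "snd ` set_pmf \<mu> \<subseteq> blocked_configs"
    and stationary: "bind_pmf \<mu> (\<lambda>(x, y). map_pmf (\<lambda>z. (x(fst z := snd z), step z y)) noise) = \<mu>"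
    and e: "e \<in> E"
    and rare: "\<And>j. j < T \<Longrightarrow>
      inner_prod (\<lambda>w. of_bool (A w)) ((avg E ^^ j) (\<lambda>w. of_bool (conn (w(e := True)))))
        \<le> \<epsilon> * inner_prod (\<lambda>_. 1) (\<lambda>w. of_bool (A w))"
  shows "(\<integral>\<^sup>+s. of_bool (fst s e \<noteq> snd s e \<and> A (snd s)) \<partial>\<mu>)
    \<le> (of_nat T * \<epsilon> / of_nat (card E) + ennreal ((real (card E) - 1) / real (card E)) ^ T) * (\<integral>\<^sup>+s. of_bool (A (snd s)) \<partial>\<mu>)"
proof -
  define piv where "piv = (\<lambda>w. of_bool (conn (w(e := True))) :: ennreal)"
  define u where "u g = (\<integral>\<^sup>+s. of_bool (fst s e \<noteq> snd s e) * g (snd s) \<partial>\<mu>)" for g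
  let ?\<nu> = "map_pmf snd \<mu>"
  let ?M = "of_nat (card E) :: ennreal"
  \<comment> \<open>One step on the event that \<open>e\<close> is not chosen.\<close>
  define Q where "Q = avg (E - {e})"
  have int_mu: "(\<integral>\<^sup>+s. F s \<partial>\<mu>) = (\<integral>\<^sup>+s. (\<integral>\<^sup>+z. F ((fst s)(fst z := snd z), step z (snd s)) \<partial>noise) \<partial>\<mu>)" for F :: "_ \<Rightarrow> ennreal"
    by (subst stationary[symmetric]) (simp add: case_prod_unfold)
  have "\<exists>k. \<forall>g. (\<integral>\<^sup>+y. g y \<partial>?\<nu>) = inner_prod (\<lambda>_. k) g"
  proof (rule stationary_unique[of ?\<nu>])
    show "(\<integral>\<^sup>+y. avg E g y \<partial>?\<nu>) = (\<integral>\<^sup>+y. g y \<partial>?\<nu>)" for g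
      using int_mu[of "\<lambda>s. g (snd s)"] by (simp add: avg_E)
    show "set_pmf ?\<nu> \<subseteq> blocked_configs"
      using supp by simp
  qed blast
  then obtain k where k: "(\<integral>\<^sup>+s. g (snd s) \<partial>\<mu>) = inner_prod (\<lambda>_. k) g" for g
    by auto
  have k': "(\<integral>\<^sup>+s. h (snd s) * g (snd s) \<partial>\<mu>) = k * inner_prod h g" for h g
    unfolding k[of "\<lambda>y. h y * g y"] inner_prod_def
    by (subst nn_integral_cmult[symmetric]) (auto intro!: nn_integral_cong)
  have one_step: "u g \<le> k * inner_prod piv g / ?M + u (Q g)" for g
  proof -
    have "u g \<le> (\<integral>\<^sup>+s. of_bool (fst s e \<noteq> snd s e) * Q g (snd s) + piv (snd s) * g (snd s) / ?M \<partial>\<mu>)"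
      unfolding u_def Q_def piv_def
    proof (subst int_mu, rule nn_integral_mono_AE, rule AE_pmfI)
      fix s assume "s \<in> set_pmf \<mu>"
      then have "snd s \<in> blocked_configs"
        using supp by blast
      from one_update_disagreement[OF this e, of "fst s" g]
      show "(\<integral>\<^sup>+z. of_bool (fst ((fst s)(fst z := snd z), step z (snd s)) e
            \<noteq> snd ((fst s)(fst z := snd z), step z (snd s)) e)
            * g (snd ((fst s)(fst z := snd z), step z (snd s))) \<partial>noise)
          \<le> of_bool (fst s e \<noteq> snd s e) * avg (E - {e}) g (snd s)
            + of_bool (conn ((snd s)(e := True))) * g (snd s) / of_nat (card E)"
        unfolding fst_conv snd_conv .
    qed
    also have "\<dots> = u (Q g) + k * inner_prod piv g / ?M"
      by (simp add: nn_integral_add u_def nn_integral_divide k')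
    finally show ?thesis
      by (simp add: add.commute)
  qed
  have iterate: "u g \<le> (\<Sum>j<t. k * inner_prod piv ((Q ^^ j) g) / ?M) + u ((Q ^^ t) g)" for g t
  proof (induction t)
    case (Suc t)
    show ?case
      using order.trans[OF Suc add_left_mono[OF one_step[of "(Q ^^ t) g"]]]
      by (simp only: sum.lessThan_Suc funpow.simps comp_apply add.assoc)
  qed simp
  let ?a = "\<lambda>w. of_bool (A w) :: ennreal"
  have first: "k * inner_prod piv ((Q ^^ j) ?a) / ?M \<le> k * (\<epsilon> * inner_prod (\<lambda>_. 1) ?a) / ?M" if "j < T" for j
  proof (intro divide_right_mono_ennreal mult_left_mono)
    have "inner_prod piv ((Q ^^ j) ?a) = inner_prod ?a ((Q ^^ j) piv)"
      unfolding Q_def inner_prod_commute[of ?a] by (rule avg_power_self_adjoint) blast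
    also have "\<dots> \<le> inner_prod ?a ((avg E ^^ j) piv)"
      unfolding inner_prod_def Q_def
      by (intro nn_integral_mono) (simp add: mult_left_mono avg_power_mono)
    also have "\<dots> \<le> \<epsilon> * inner_prod (\<lambda>_. 1) ?a"
      using rare[OF that] by (simp add: piv_def)
    finally show "inner_prod piv ((Q ^^ j) ?a) \<le> \<epsilon> * inner_prod (\<lambda>_. 1) ?a" .
  qed simp
  have Q_const: "(Q ^^ t) (\<lambda>_. 1) = (\<lambda>_. ennreal ((real (card E) - 1) / real (card E)) ^ t)" for t
  proof (induction t)
    case (Suc t)
    have "real (card (E - {e})) = real (card E) - 1"
      using e finite_E nonempty_E by (simp add: of_nat_diff Suc_leI card_gt_0_iff)
    then have "Q (\<lambda>_. a) = (\<lambda>_. ennreal ((real (card E) - 1) / real (card E)) * a)" for a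
      unfolding Q_def by (intro ext) (simp only: avg_const)
    then show ?case
      by (simp only: funpow.simps comp_apply Suc power_Suc)
  qed simp
  have "u ((Q ^^ T) ?a) \<le> (\<integral>\<^sup>+s. 1 * (Q ^^ T) ?a (snd s) \<partial>\<mu>)"
    unfolding u_def by (intro nn_integral_mono mult_right_mono) auto
  also have "\<dots> = k * inner_prod ((Q ^^ T) (\<lambda>_. 1)) ?a"
    using k'[of "\<lambda>_. 1" "(Q ^^ T) ?a"] avg_power_self_adjoint[of "E - {e}" "\<lambda>_. 1" T ?a]
    by (simp add: Q_def)
  also have "\<dots> = ennreal ((real (card E) - 1) / real (card E)) ^ T * (k * inner_prod (\<lambda>_. 1) ?a)"
    unfolding Q_const inner_prod_const[of "_ ^ T"] by (simp add: mult.left_commute)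
  finally have last: "u ((Q ^^ T) ?a) \<le> ennreal ((real (card E) - 1) / real (card E)) ^ T * (k * inner_prod (\<lambda>_. 1) ?a)" .
  have "u ?a \<le> (\<Sum>j<T. k * (\<epsilon> * inner_prod (\<lambda>_. 1) ?a) / ?M)
      + ennreal ((real (card E) - 1) / real (card E)) ^ T * (k * inner_prod (\<lambda>_. 1) ?a)"
    by (rule order.trans[OF iterate[of ?a T]], intro add_mono sum_mono first last) simp
  also have "\<dots> = (of_nat T * \<epsilon> / ?M + ennreal ((real (card E) - 1) / real (card E)) ^ T) * (k * inner_prod (\<lambda>_. 1) ?a)"
    unfolding distrib_right by (rule arg_cong2[of _ _ _ _ "(+)"]) (simp_all add: divide_ennreal_def mult_ac)
  also have "k * inner_prod (\<lambda>_. 1) ?a = (\<integral>\<^sup>+s. of_bool (A (snd s)) \<partial>\<mu>)"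
    using k'[of "\<lambda>_. 1" ?a] by simp
  finally show ?thesis
    unfolding u_def of_bool_conj .
qed

end

lemma rtrancl_path_successively:
  "rtrancl_path R x xs y \<Longrightarrow> successively R (x # xs) \<and> last (x # xs) = y"
  by (induction rule: rtrancl_path.induct) auto

section \<open>Tracing pivotal edges back in space and time\<close>

text \<open>
  \<open>\<delta>\<close> stands for the distance to a fixed edge and \<open>adj\<close> for a relation of bounded degree between edges
  at bounded distance. The hypothesis \<open>pivotal_path\<close> is what the geometry of cuts provides: a pivotal
  edge belongs to a connected set of closed edges that contains a far edge.
\<close>

locale localized_dynamics = conditioned_dynamics E conn p
  for E :: "'e set" and conn p +
  fixes adj :: "'e \<Rightarrow> 'e \<Rightarrow> bool" and \<delta> :: "'e \<Rightarrow> real" and r :: real and D :: nat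
  assumes \<delta>_adj: "f \<in> E \<Longrightarrow> g \<in> E \<Longrightarrow> adj f g \<Longrightarrow> \<delta> g \<le> \<delta> f + 2"
    and degree: "f \<in> E \<Longrightarrow> card {g\<in>E. adj f g} \<le> D" and D_pos: "1 \<le> D"
    and pivotal_path: "\<not> conn y \<Longrightarrow> f \<in> E \<Longrightarrow> \<delta> f < r \<Longrightarrow> conn (y(f := True)) \<Longrightarrow>
      \<exists>g\<in>E. r \<le> \<delta> g \<and> (f, g) \<in> {(a, b). a \<in> E \<and> b \<in> E \<and> adj a b \<and> \<not> y a \<and> \<not> y b}\<^sup>*"
begin

definition nearby :: "'e set" where
  "nearby = {f\<in>E. \<delta> f < r}"

text \<open>
  The existence of a closed cut without nearby edges, in a form which shows that this event ignores the
  state of the nearby edges.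
\<close>

definition far_blocked :: "('e \<Rightarrow> bool) \<Rightarrow> bool" where
  "far_blocked y \<longleftrightarrow> \<not> conn (\<lambda>f. f \<in> nearby \<or> y f)"

lemma nearby_subset: "nearby \<subseteq> E"
  by (auto simp: nearby_def)

lemma far_blocked_imp: "far_blocked y \<Longrightarrow> \<not> conn y"
  unfolding far_blocked_def by (erule contrapos_nn, erule conn_mono) auto

lemma far_blocked_upd: "f \<in> nearby \<Longrightarrow> far_blocked (y(f := b)) = far_blocked y"
proof -
  assume "f \<in> nearby"
  then have "(\<lambda>g. g \<in> nearby \<or> (y(f := b)) g) = (\<lambda>g. g \<in> nearby \<or> y g)"
    by (auto simp: fun_eq_iff)
  then show ?thesis
    by (simp add: far_blocked_def)
qed

text \<open>
  The dynamics without refusals, on the nearby edges. The other edges are frozen, so that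
  \<open>far_blocked\<close> is preserved.
\<close>

definition free_step :: "'e \<times> bool \<Rightarrow> ('e \<Rightarrow> bool) \<Rightarrow> 'e \<Rightarrow> bool" where
  "free_step z w = (if fst z \<in> nearby then w(fst z := snd z) else w)"

definition free_run :: "('e \<times> bool) list \<Rightarrow> ('e \<Rightarrow> bool) \<Rightarrow> 'e \<Rightarrow> bool" where
  "free_run ns = fold free_step ns"

text \<open>
  A block consists of \<open>card E\<close> steps, the time scale on which a given edge is updated once on average.
\<close>

definition closed_in_block :: "('e \<Rightarrow> bool) \<Rightarrow> ('e \<times> bool) list \<Rightarrow> nat \<Rightarrow> 'e set" where
  "closed_in_block w ns i
    = {f\<in>nearby. \<exists>t\<le>length ns. t div card E = i \<and> \<not> free_run (take t ns) w f}"

definition adj_paths :: "nat \<Rightarrow> 'e list set" where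
  "adj_paths l = {xs. length xs = l \<and> distinct xs \<and> successively adj xs \<and> set xs \<subseteq> nearby}"

text \<open>
  A shortest path through \<open>W\<close> visits distinct elements of \<open>W\<close>, so it has fewer than \<open>l\<close> steps, and each
  of them increases \<open>\<delta>\<close> by at most 2.
\<close>

lemma reach_short:
  assumes reach: "(f, g) \<in> {(a, b). adj a b \<and> a \<in> W \<and> b \<in> E}\<^sup>*" and f: "f \<in> E" and W: "W \<subseteq> nearby"
    and no_path: "\<And>xs. xs \<in> adj_paths l \<Longrightarrow> \<not> set xs \<subseteq> W"
  shows "\<delta> g \<le> \<delta> f + 2 * real l"
proof -
  let ?R = "\<lambda>a b. adj a b \<and> a \<in> W \<and> b \<in> E"
  have "?R\<^sup>*\<^sup>* f g"
    using reach by (simp add: rtranclp_rtrancl_eq)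
  then obtain xs where "rtrancl_path ?R f xs g"
    by (auto simp: rtranclp_eq_rtrancl_path)
  then obtain xs where path: "rtrancl_path ?R f xs g" and dist: "distinct (f # xs)"
    by (rule rtrancl_path_distinct)
  have succ: "successively ?R (f # xs)"
    using rtrancl_path_successively[OF path] by blast
  have "length xs < l"
  proof (rule ccontr)
    assume "\<not> length xs < l"
    then have len: "l \<le> length xs" by simp
    let ?ys = "take l (f # xs)"
    have in_W: "?ys ! i \<in> W" if "i < l" for i
      using succ that len by (auto simp: successively_conv_nth)
    have "set ?ys \<subseteq> W"
      using in_W len by (auto simp: in_set_conv_nth simp del: take_Suc_Cons)
    moreover have "successively adj ?ys"
      using succ len by (auto simp: successively_conv_nth simp del: take_Suc_Cons)
    moreover have "distinct ?ys"
      using dist by (rule distinct_take)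
    ultimately have "?ys \<in> adj_paths l"
      using len W by (auto simp: adj_paths_def)
    then show False
      using no_path \<open>set ?ys \<subseteq> W\<close> by blast
  qed
  moreover have "\<delta> g \<le> \<delta> f + 2 * real (length xs)"
    using path f
  proof (induction rule: rtrancl_path.induct)
    case (step x y ys z)
    then have "x \<in> E" "y \<in> E" "adj x y" "\<delta> z \<le> \<delta> y + 2 * real (length ys)"
      by auto
    with \<delta>_adj[of x y] show ?case
      by simp
  qed simp
  ultimately show ?thesis
    by simp
qed

lemma step_not_conn: "\<not> conn y \<Longrightarrow> \<not> conn (step z y)"
  by (cases z; cases "snd z \<and> \<not> conn (y(fst z := True))") (auto simp: step_def conn_close)

lemma run_not_conn: "\<not> conn y \<Longrightarrow> \<not> conn (run ns y)"
  unfolding run_def by (induction ns arbitrary: y) (auto simp: step_not_conn)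

text \<open>
  Let \<open>y\<close> be the conditioned dynamics and \<open>x\<close> the free one. If a nearby edge is closed in \<open>y\<close> and open
  in \<open>x\<close>, then its last update refused an opening, and at that time the edge was pivotal. From a pivotal
  edge \<open>pivotal_path\<close> provides a path of edges closed in \<open>y\<close> to a far edge. Its first part consists of
  edges that are closed in \<open>x\<close> as well, hence belong to \<open>closed_in_block\<close>; it ends at a far edge or at a
  discrepancy, from which the same reasoning goes on at an earlier time. Whenever this exploration
  passes to an earlier block, \<open>reach_short\<close> converts the path in the block just left into a gain of at
  most \<open>2 * l\<close> in \<open>\<delta>\<close>.
\<close>

lemma pivotal_trace:
  assumes w: "\<not> conn w"
    and no_path: "\<And>i xs. i \<le> length ns div card E \<Longrightarrow> xs \<in> adj_paths l \<Longrightarrow> \<not> set xs \<subseteq> closed_in_block w ns i"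
    and f: "f \<in> nearby" "conn ((run ns w)(f := True))"
  shows "r \<le> \<delta> f + 2 * real l * (real (length ns div card E) + 1)"
proof -
  define y where "y t = run (take t ns) w" for t
  define x where "x t = free_run (take t ns) w" for t
  let ?W = "closed_in_block w ns"
  \<comment> \<open>\<open>C i a\<close>: within block \<open>i\<close>, the edge \<open>a\<close> is linked to the region that earlier blocks give access to.\<close>
  define C where "C i a \<longleftrightarrow> (\<exists>g\<in>E. r \<le> \<delta> g + 2 * real l * real i
      \<and> (a, g) \<in> {(a, b). adj a b \<and> a \<in> ?W i \<and> b \<in> E}\<^sup>*)" for i a
  let ?N = "length ns" and ?M = "card E"
  have C_far: "C i a" if "a \<in> E" "r \<le> \<delta> a + 2 * real l * real i" for i a
    using that unfolding C_def by blast
  have C_bound: "r \<le> \<delta> a + 2 * real l * (real i + 1)" if a: "a \<in> E" "C i a" "i \<le> ?N div ?M" for i a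
  proof -
    obtain g where g: "r \<le> \<delta> g + 2 * real l * real i"
        "(a, g) \<in> {(a, b). adj a b \<and> a \<in> ?W i \<and> b \<in> E}\<^sup>*"
      using a(2) unfolding C_def by blast
    have "\<delta> g \<le> \<delta> a + 2 * real l"
      by (rule reach_short[OF g(2) a(1) _ no_path[OF a(3)]]) (auto simp: closed_in_block_def)
    with g(1) show ?thesis
      by (simp add: algebra_simps)
  qed
  have C_next: "C (Suc t div ?M) a" if "a \<in> E" "C (t div ?M) a" "t \<le> ?N" for t a
  proof (cases "Suc t div ?M = t div ?M")
    case False
    then have "Suc t div ?M = Suc (t div ?M)"
      by (auto simp: div_Suc split: if_splits)
    then show ?thesis
      using C_bound[OF that(1,2) div_le_mono[OF that(3)]] that(1) by (intro C_far) (auto simp: add.commute)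
  qed (use that in simp)
  have pivotal: "C (t div ?M) a"
    if t: "t \<le> ?N" and a: "a \<in> nearby" "conn ((y t)(a := True))"
      and IH: "\<And>b. b \<in> nearby \<Longrightarrow> \<not> y t b \<Longrightarrow> x t b \<Longrightarrow> C (t div ?M) b" for t a
  proof -
    have "\<not> conn (y t)"
      unfolding y_def by (rule run_not_conn[OF w])
    moreover have "a \<in> E" "\<delta> a < r"
      using a(1) by (auto simp: nearby_def)
    ultimately obtain g where g: "g \<in> E" "r \<le> \<delta> g"
        and reach: "(a, g) \<in> {(a, b). a \<in> E \<and> b \<in> E \<and> adj a b \<and> \<not> y t a \<and> \<not> y t b}\<^sup>*"
      using pivotal_path[of "y t" a] a(2) by blast
    from reach show ?thesis
    proof (induction rule: converse_rtrancl_induct)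
      case base
      show ?case using g by (intro C_far) (auto intro: order.trans)
    next
      case (step b c)
      then have b: "b \<in> E" "c \<in> E" "adj b c" "\<not> y t b"
        by auto
      consider "b \<notin> nearby" | "b \<in> nearby" "x t b" | "b \<in> nearby" "\<not> x t b" by blast
      then show ?case
      proof cases
        case 1
        then have "r \<le> \<delta> b" using b by (simp add: nearby_def)
        then show ?thesis using b by (intro C_far) (auto intro: order.trans)
      next
        case 2
        then show ?thesis using IH b by blast
      next
        case 3
        then have "b \<in> ?W (t div ?M)"
          unfolding closed_in_block_def x_def using t by blast
        then have "(b, c) \<in> {(a, b). adj a b \<and> a \<in> ?W (t div ?M) \<and> b \<in> E}"
          using b by blast
        with step.IH show ?thesis
          unfolding C_def by (meson converse_rtrancl_into_rtrancl)
      qed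
    qed
  qed
  have discrepancy: "C (t div ?M) a" if "t \<le> ?N" "a \<in> nearby" "\<not> y t a" "x t a" for t a
    using that
  proof (induction t arbitrary: a)
    case 0
    then show ?case by (simp add: x_def y_def run_def free_run_def)
  next
    case (Suc t)
    let ?z = "ns ! t"
    have "take (Suc t) ns = take t ns @ [?z]"
      using Suc.prems by (simp add: take_Suc_conv_app_nth)
    then have y: "y (Suc t) = step ?z (y t)" and x: "x (Suc t) = free_step ?z (x t)"
      by (simp_all add: y_def x_def run_def free_run_def)
    have "C (t div ?M) a"
    proof (cases "fst ?z = a")
      case True
      then have blocked: "snd ?z" "conn ((y t)(a := True))"
        using Suc.prems y x by (auto simp: step_def free_step_def case_prod_unfold)
      show ?thesis
        by (rule pivotal[rotated 3, OF Suc.IH]) (use Suc.prems blocked in simp_all)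
    next
      case False
      then have "\<not> y t a \<and> x t a"
        using Suc.prems y x by (auto simp: step_def free_step_def case_prod_unfold split: if_splits)
      then show ?thesis
        using Suc.prems by (auto intro: Suc.IH)
    qed
    then show ?case
      using Suc.prems nearby_subset by (intro C_next) auto
  qed
  have "C (?N div ?M) f"
    by (rule pivotal[rotated 3, OF discrepancy]) (use f in \<open>simp_all add: y_def\<close>)
  then show ?thesis
    using C_bound[of f "?N div ?M"] f nearby_subset by auto
qed


text \<open>
  Percolation restricted to \<open>far_blocked\<close> is stationary for the free dynamics, because the event ignores
  the nearby edges and the free dynamics only redraws those.
\<close>

lemma free_run_invariant:
  "(\<integral>\<^sup>+w. of_bool (far_blocked w) * (\<integral>\<^sup>+ns. F (free_run ns w) \<partial>replicate_pmf m noise) \<partial>percolation)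
    = (\<integral>\<^sup>+w. of_bool (far_blocked w) * F w \<partial>percolation)"
proof (induction m arbitrary: F)
  case 0
  show ?case by (simp add: free_run_def)
next
  case (Suc m)
  have one: "(\<integral>\<^sup>+w. of_bool (far_blocked w) * (ennreal p * G (free_step (f, True) w)
        + ennreal (1 - p) * G (free_step (f, False) w)) \<partial>percolation) = (\<integral>\<^sup>+w. of_bool (far_blocked w) * G w \<partial>percolation)"
    if f: "f \<in> E" for f and G :: "('e \<Rightarrow> bool) \<Rightarrow> ennreal"
  proof (cases "f \<in> nearby")
    case True
    then show ?thesis
      by (subst (2) percolation_resample[OF f]) (simp add: free_step_def far_blocked_upd distrib_left mult.left_commute)
  next
    case False
    then show ?thesis
      by (simp add: free_step_def bernoulli_mix_const)
  qed
  define G where "G w = (\<integral>\<^sup>+ns. F (free_run ns w) \<partial>replicate_pmf m noise)" for w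
  have "(\<integral>\<^sup>+w. of_bool (far_blocked w) * (\<integral>\<^sup>+ns. F (free_run ns w) \<partial>replicate_pmf (Suc m) noise) \<partial>percolation)
      = (\<integral>\<^sup>+w. of_bool (far_blocked w) * (\<integral>\<^sup>+z. G (free_step z w) \<partial>noise) \<partial>percolation)"
    by (simp add: free_run_def G_def)
  also have "\<dots> = (\<integral>\<^sup>+w. (\<Sum>f\<in>E. of_bool (far_blocked w) * (ennreal p * G (free_step (f, True) w)
        + ennreal (1 - p) * G (free_step (f, False) w))) / of_nat (card E) \<partial>percolation)"
    by (simp add: nn_integral_noise ennreal_times_divide sum_distrib_left)
  also have "\<dots> = (\<Sum>f\<in>E. \<integral>\<^sup>+w. of_bool (far_blocked w) * (ennreal p * G (free_step (f, True) w)
        + ennreal (1 - p) * G (free_step (f, False) w)) \<partial>percolation) / of_nat (card E)"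
    by (subst nn_integral_divide) (auto intro!: arg_cong2[of _ _ _ _ "(/)"] nn_integral_sum)
  also have "\<dots> = (\<Sum>f\<in>E. \<integral>\<^sup>+w. of_bool (far_blocked w) * G w \<partial>percolation) / of_nat (card E)"
    by (intro arg_cong2[of _ _ _ _ "(/)"] sum.cong one refl)
  also have "\<dots> = (\<integral>\<^sup>+w. of_bool (far_blocked w) * G w \<partial>percolation)"
    using finite_E nonempty_E
    by (simp add: mult.commute[of "of_nat _"] ennreal_mult_divide_eq)
  finally show ?case
    unfolding G_def Suc.IH .
qed

text \<open>
  For the same reason the nearby edges remain independent under the restricted measure.
\<close>

lemma all_initially_closed:
  assumes "S \<subseteq> nearby"
  shows "(\<integral>\<^sup>+w. of_bool (far_blocked w) * of_bool (\<forall>g\<in>S. \<not> w g) \<partial>percolation)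
    = ennreal (1 - p) ^ card S * (\<integral>\<^sup>+w. of_bool (far_blocked w) \<partial>percolation)"
  using finite_subset[OF assms finite_subset[OF nearby_subset finite_E]] assms
proof (induction S rule: finite_induct)
  case (insert f S)
  have "f \<in> E"
    using insert nearby_subset by auto
  have eq: "of_bool (far_blocked (w(f := b))) * of_bool (\<forall>g\<in>insert f S. \<not> (w(f := b)) g)
      = of_bool (far_blocked w) * (of_bool (\<not> b) * of_bool (\<forall>g\<in>S. \<not> w g) :: ennreal)" for w b
  proof -
    have "(\<forall>g\<in>insert f S. \<not> (w(f := b)) g) \<longleftrightarrow> \<not> b \<and> (\<forall>g\<in>S. \<not> w g)"
      using insert.hyps(2) by auto
    then show ?thesis
      using insert.prems far_blocked_upd[of f w b] by (simp add: of_bool_conj)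
  qed
  show ?case
    unfolding percolation_resample[OF \<open>f \<in> E\<close>, of "\<lambda>w. of_bool (far_blocked w) * of_bool (\<forall>g\<in>insert f S. \<not> w g)"] eq
    using insert by (simp add: nn_integral_cmult mult.assoc)
qed simp

text \<open>
  A first draw equal to \<open>(g, False)\<close> with \<open>g \<in> S\<close> leaves \<open>S - {g}\<close> to be collected, and any other draw
  leaves \<open>S\<close>. With \<open>x = (1 - p) / card E\<close>, the bound \<open>(k * x) ^ card S\<close> is propagated by this recursion,
  because \<open>a ^ s + s * x * a ^ (s - 1)\<close> consists of two terms of the expansion of \<open>(a + x) ^ s\<close>.
\<close>

lemma coupon_bound:
  assumes "S \<subseteq> E"
  shows "(\<integral>\<^sup>+ns. of_bool (\<forall>g\<in>S. (g, False) \<in> set (take k ns)) \<partial>replicate_pmf m noise)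
    \<le> ennreal (real k * ((1 - p) / real (card E))) ^ card S"
proof -
  define x where "x = (1 - p) / real (card E)"
  have x: "0 \<le> x"
    using p_less by (simp add: x_def)
  have "(\<integral>\<^sup>+ns. of_bool (\<forall>g\<in>S. (g, False) \<in> set (take k ns)) \<partial>replicate_pmf m noise)
      \<le> ennreal ((real k * x) ^ card S)"
    using assms
  proof (induction m arbitrary: k S)
    case 0
    then show ?case by (cases "S = {}") auto
  next
    case (Suc m)
    have finS: "finite S"
      using Suc.prems finite_E finite_subset by blast
    show ?case
    proof (cases k)
      case 0
      then show ?thesis by (cases "S = {}") auto
    next
      case (Suc k')
      define H where "H S = (\<integral>\<^sup>+ns. of_bool (\<forall>g\<in>S. (g, False) \<in> set (take k' ns)) \<partial>replicate_pmf m noise)" for S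
      have H: "H S' \<le> ennreal ((real k' * x) ^ card S')" if "S' \<subseteq> E" for S'
        using Suc.IH[OF that] by (simp add: H_def)
      have "(\<integral>\<^sup>+ns. of_bool (\<forall>g\<in>S. (g, False) \<in> set (take k ns)) \<partial>replicate_pmf (Suc m) noise)
          = (\<integral>\<^sup>+z. \<integral>\<^sup>+ns. of_bool (\<forall>g\<in>S. (g, False) = z \<or> (g, False) \<in> set (take k' ns)) \<partial>replicate_pmf m noise \<partial>noise)"
        by (simp add: Suc)
      also have "\<dots> \<le> (\<integral>\<^sup>+z. H S + (\<Sum>g\<in>S. of_bool (z = (g, False)) * H (S - {g})) \<partial>noise)"
      proof (rule nn_integral_mono)
        fix z
        show "(\<integral>\<^sup>+ns. of_bool (\<forall>g\<in>S. (g, False) = z \<or> (g, False) \<in> set (take k' ns)) \<partial>replicate_pmf m noise)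
            \<le> H S + (\<Sum>g\<in>S. of_bool (z = (g, False)) * H (S - {g}))"
        proof (cases "\<exists>g\<in>S. z = (g, False)")
          case True
          then obtain g where g: "g \<in> S" "z = (g, False)" by blast
          have "(\<integral>\<^sup>+ns. of_bool (\<forall>g\<in>S. (g, False) = z \<or> (g, False) \<in> set (take k' ns)) \<partial>replicate_pmf m noise)
              \<le> H (S - {g})"
            unfolding H_def by (intro nn_integral_mono) (use g in auto)
          also have "H (S - {g}) = of_bool (z = (g, False)) * H (S - {g})"
            using g by simp
          also have "\<dots> \<le> (\<Sum>g\<in>S. of_bool (z = (g, False)) * H (S - {g}))"
            using g finS by (intro member_le_sum) auto
          finally show ?thesis
            by (rule order.trans) simp
        next
          case False
          then have "(\<forall>g\<in>S. (g, False) = z \<or> (g, False) \<in> set (take k' ns)) \<longleftrightarrow> (\<forall>g\<in>S. (g, False) \<in> set (take k' ns))" for ns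
            by auto
          then show ?thesis
            by (simp add: H_def)
        qed
      qed
      also have "\<dots> = H S + (\<Sum>g\<in>S. ennreal x * H (S - {g}))"
      proof -
        have "(\<integral>\<^sup>+z. of_bool (z = (g, False)) * a \<partial>noise) = ennreal x * a" if "g \<in> S" for g and a :: ennreal
        proof -
          have "(\<integral>\<^sup>+z. of_bool (z = (g, False)) * a \<partial>noise)
              = (\<Sum>f\<in>E. if f = g then ennreal (1 - p) * a else 0) / of_nat (card E)"
            unfolding nn_integral_noise by (intro arg_cong2[of _ _ _ _ "(/)"] sum.cong) auto
          also have "\<dots> = ennreal x * a"
            using that Suc.prems finite_E nonempty_E p_less
            by (auto simp: x_def divide_ennreal[symmetric] ennreal_of_nat_eq_real_of_nat card_gt_0_iff
                  divide_ennreal_def mult_ac)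
          finally show ?thesis .
        qed
        then show ?thesis
          by (subst nn_integral_add, simp, simp, subst nn_integral_sum) simp_all
      qed
      also
      have H_remove: "H (S - {g}) \<le> ennreal ((real k' * x) ^ (card S - 1))" if "g \<in> S" for g
        using H[of "S - {g}"] that Suc.prems finS by (auto simp: card_Diff_singleton)
      have "H S + (\<Sum>g\<in>S. ennreal x * H (S - {g})) \<le> ennreal ((real k' * x) ^ card S)
          + (\<Sum>g\<in>S. ennreal x * ennreal ((real k' * x) ^ (card S - 1)))"
        using H[of S] Suc.prems by (intro add_mono sum_mono mult_left_mono H_remove) auto
      also have "\<dots> = ennreal ((real k' * x) ^ card S + real (card S) * x * (real k' * x) ^ (card S - 1))"
        using x by (simp add: ennreal_mult ennreal_of_nat_eq_real_of_nat mult.assoc)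
      also have "\<dots> \<le> ennreal ((real k * x) ^ card S)"
      proof (rule ennreal_leI)
        show "(real k' * x) ^ card S + real (card S) * x * (real k' * x) ^ (card S - 1) \<le> (real k * x) ^ card S"
        proof (cases "card S")
          case 0
          then show ?thesis by simp
        next
          case (Suc s)
          have "(real k * x) ^ card S = (real k' * x + x) ^ Suc s"
            using \<open>k = Suc k'\<close> Suc by (simp add: algebra_simps)
          moreover have "(a + x) ^ Suc s \<ge> a ^ Suc s + real (Suc s) * x * a ^ s" if "0 \<le> a" for a
          proof -
            have "a ^ Suc s + real (Suc s) * x * a ^ s
                = (\<Sum>i\<in>{s, Suc s}. real (Suc s choose i) * a ^ i * x ^ (Suc s - i))"
              by simp
            also have "\<dots> \<le> (\<Sum>i\<le>Suc s. real (Suc s choose i) * a ^ i * x ^ (Suc s - i))"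
              using that x by (intro sum_mono2) auto
            finally show ?thesis
              unfolding binomial_ring .
          qed
          ultimately show ?thesis
            using Suc x by simp
        qed
      qed
      finally show ?thesis .
    qed
  qed
  then show ?thesis
    unfolding x_def[symmetric] using x by (subst ennreal_power) auto
qed

text \<open>
  An edge closed at some time of a block is closed when the block begins or is updated with coin
  \<open>False\<close> during the block. Sum over the set \<open>S1\<close> of the edges of \<open>S\<close> closed at the beginning: each
  of the \<open>2 ^ card S\<close> terms is at most \<open>(1 - p) ^ card S\<close>.
\<close>

lemma closed_in_block_bound:
  assumes S: "S \<subseteq> nearby" and i: "i * card E \<le> m"
  shows "(\<integral>\<^sup>+w. of_bool (far_blocked w) * (\<integral>\<^sup>+ns. of_bool (S \<subseteq> closed_in_block w ns i) \<partial>replicate_pmf m noise) \<partial>percolation)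
    \<le> ennreal (2 * (1 - p)) ^ card S * (\<integral>\<^sup>+w. of_bool (far_blocked w) \<partial>percolation)"
proof -
  let ?M = "card E"
  let ?a = "i * ?M" and ?b = "m - i * ?M"
  have M: "0 < ?M"
    using finite_E nonempty_E by (simp add: card_gt_0_iff)
  have finS: "finite S"
    using S nearby_subset finite_E by (meson finite_subset)
  define hit where "hit S ns \<longleftrightarrow> (\<forall>g\<in>S. (g, False) \<in> set (take ?M ns))" for S and ns :: "('e \<times> bool) list"
  define H where "H w = (\<integral>\<^sup>+ns. of_bool (\<forall>g\<in>S. \<not> w g \<or> (g, False) \<in> set (take ?M ns)) \<partial>replicate_pmf ?b noise)" for w
  have closed_imp: "\<not> w g \<or> (g, False) \<in> set ns" if "\<not> free_run ns w g" for w g ns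
    using that
  proof (induction ns rule: rev_induct)
    case (snoc z ns)
    then show ?case
      by (cases z) (auto simp: free_run_def free_step_def split: if_splits)
  qed (simp add: free_run_def)
  have cover: "\<not> free_run ns1 w g \<or> (g, False) \<in> set (take ?M ns2)"
    if block: "g \<in> closed_in_block w (ns1 @ ns2) i" and len: "length ns1 = ?a" for w g ns1 ns2
  proof -
    obtain t where t: "t div ?M = i" "\<not> free_run (take t (ns1 @ ns2)) w g"
      using block unfolding closed_in_block_def by blast
    have "?a \<le> t" "t - ?a \<le> ?M"
      using div_mult_mod_eq[of t ?M] mod_less_divisor[OF M, of t] unfolding t(1) by linarith+
    have "free_run (take t (ns1 @ ns2)) w = free_run (take (t - ?a) ns2) (free_run ns1 w)"
      using len \<open>?a \<le> t\<close> by (simp add: free_run_def)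
    then have "\<not> free_run ns1 w g \<or> (g, False) \<in> set (take (t - ?a) ns2)"
      using closed_imp t(2) by metis
    then show ?thesis
      using set_take_subset_set_take[OF \<open>t - ?a \<le> ?M\<close>, of ns2] by blast
  qed
  have "(\<integral>\<^sup>+ns. of_bool (S \<subseteq> closed_in_block w ns i) \<partial>replicate_pmf m noise)
      \<le> (\<integral>\<^sup>+ns. H (free_run ns w) \<partial>replicate_pmf ?a noise)" for w
  proof -
    have split: "replicate_pmf m noise = bind_pmf (replicate_pmf ?a noise)
        (\<lambda>ns1. bind_pmf (replicate_pmf ?b noise) (\<lambda>ns2. return_pmf (ns1 @ ns2)))"
      using replicate_pmf_distrib[of ?a ?b noise] i by simp
    have "(\<integral>\<^sup>+ns. of_bool (S \<subseteq> closed_in_block w ns i) \<partial>replicate_pmf m noise)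
        = (\<integral>\<^sup>+ns1. \<integral>\<^sup>+ns2. of_bool (S \<subseteq> closed_in_block w (ns1 @ ns2) i) \<partial>replicate_pmf ?b noise \<partial>replicate_pmf ?a noise)"
      unfolding split by simp
    also have "\<dots> \<le> (\<integral>\<^sup>+ns. H (free_run ns w) \<partial>replicate_pmf ?a noise)"
      unfolding H_def
    proof (rule nn_integral_mono_AE, rule AE_pmfI, rule nn_integral_mono)
      fix ns1 ns2 assume "ns1 \<in> set_pmf (replicate_pmf ?a noise)"
      then have "length ns1 = ?a"
        by (simp add: set_replicate_pmf)
      then show "of_bool (S \<subseteq> closed_in_block w (ns1 @ ns2) i)
          \<le> (of_bool (\<forall>g\<in>S. \<not> free_run ns1 w g \<or> (g, False) \<in> set (take ?M ns2)) :: ennreal)"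
        using cover[of _ w ns1 ns2] by auto
    qed
    finally show ?thesis .
  qed
  then have "(\<integral>\<^sup>+w. of_bool (far_blocked w) * (\<integral>\<^sup>+ns. of_bool (S \<subseteq> closed_in_block w ns i) \<partial>replicate_pmf m noise) \<partial>percolation)
      \<le> (\<integral>\<^sup>+w. of_bool (far_blocked w) * (\<integral>\<^sup>+ns. H (free_run ns w) \<partial>replicate_pmf ?a noise) \<partial>percolation)"
    by (intro nn_integral_mono mult_left_mono) auto
  also have "\<dots> = (\<integral>\<^sup>+w. of_bool (far_blocked w) * H w \<partial>percolation)"
    by (rule free_run_invariant)
  also have "\<dots> \<le> (\<integral>\<^sup>+w. (\<Sum>S1\<in>Pow S. ennreal (1 - p) ^ card (S - S1)
      * (of_bool (far_blocked w) * of_bool (\<forall>g\<in>S1. \<not> w g))) \<partial>percolation)"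
  proof (rule nn_integral_mono)
    fix w
    let ?S1 = "{g\<in>S. \<not> w g}"
    have "H w \<le> (\<integral>\<^sup>+ns. of_bool (\<forall>g\<in>S - ?S1. (g, False) \<in> set (take ?M ns)) \<partial>replicate_pmf ?b noise)"
      unfolding H_def by (intro nn_integral_mono) auto
    also have "\<dots> \<le> ennreal (real ?M * ((1 - p) / real ?M)) ^ card (S - ?S1)"
      using S nearby_subset by (intro coupon_bound) auto
    also have "\<dots> = ennreal (1 - p) ^ card (S - ?S1)"
      using M by simp
    finally have "of_bool (far_blocked w) * H w \<le> ennreal (1 - p) ^ card (S - ?S1)
        * (of_bool (far_blocked w) * of_bool (\<forall>g\<in>?S1. \<not> w g))"
      by (auto simp: mult.commute)
    also have "\<dots> \<le> (\<Sum>S1\<in>Pow S. ennreal (1 - p) ^ card (S - S1)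
        * (of_bool (far_blocked w) * of_bool (\<forall>g\<in>S1. \<not> w g)))"
      using finS by (intro member_le_sum) auto
    finally show "of_bool (far_blocked w) * H w \<le> (\<Sum>S1\<in>Pow S. ennreal (1 - p) ^ card (S - S1)
        * (of_bool (far_blocked w) * of_bool (\<forall>g\<in>S1. \<not> w g)))" .
  qed
  also have "\<dots> = (\<Sum>S1\<in>Pow S. ennreal (1 - p) ^ card (S - S1)
      * (ennreal (1 - p) ^ card S1 * (\<integral>\<^sup>+w. of_bool (far_blocked w) \<partial>percolation)))"
    using S by (subst nn_integral_sum, simp, subst nn_integral_cmult, simp)
      (intro sum.cong refl arg_cong2[of _ _ _ _ "(*)"] all_initially_closed, auto)
  also have "\<dots> = (\<Sum>S1\<in>Pow S. ennreal (1 - p) ^ card S * (\<integral>\<^sup>+w. of_bool (far_blocked w) \<partial>percolation))"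
  proof (rule sum.cong[OF refl])
    fix S1 assume "S1 \<in> Pow S"
    then have "card S = card (S - S1) + card S1"
      using finS by (metis PowD card_Diff_subset card_mono finite_subset le_add_diff_inverse2)
    then show "ennreal (1 - p) ^ card (S - S1) * (ennreal (1 - p) ^ card S1 * (\<integral>\<^sup>+w. of_bool (far_blocked w) \<partial>percolation))
        = ennreal (1 - p) ^ card S * (\<integral>\<^sup>+w. of_bool (far_blocked w) \<partial>percolation)"
      by (simp add: power_add mult.assoc)
  qed
  also have "\<dots> = ennreal (2 * (1 - p)) ^ card S * (\<integral>\<^sup>+w. of_bool (far_blocked w) \<partial>percolation)"
  proof -
    have double: "ennreal (2 * (1 - p)) = 2 * ennreal (1 - p)"
      using p_less by (subst ennreal_mult) auto
    show ?thesis
      unfolding double using finS by (simp add: card_Pow power_mult_distrib mult.assoc)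
  qed
  finally show ?thesis .
qed

lemma card_adj_paths: "finite (adj_paths (Suc n)) \<and> card (adj_paths (Suc n)) \<le> card E * D ^ n"
proof (induction n)
  case 0
  have "adj_paths (Suc 0) \<subseteq> (\<lambda>f. [f]) ` E"
    using nearby_subset by (auto simp: adj_paths_def length_Suc_conv)
  then show ?case
    using finite_E by (metis card_image_le card_mono finite_imageI finite_subset le_trans mult.right_neutral power_0)
next
  case (Suc n)
  let ?P = "\<Union>xs\<in>adj_paths (Suc n). (\<lambda>g. xs @ [g]) ` {g\<in>E. adj (last xs) g}"
  have "xs \<in> ?P" if path: "xs \<in> adj_paths (Suc (Suc n))" for xs
  proof -
    obtain ys g where xs: "xs = ys @ [g]"
      using path by (cases xs rule: rev_cases) (auto simp: adj_paths_def)
    then have "ys \<in> adj_paths (Suc n)" "adj (last ys) g" "g \<in> E"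
      using path nearby_subset by (auto simp: adj_paths_def successively_append_iff)
    then show ?thesis
      using xs by auto
  qed
  then have "adj_paths (Suc (Suc n)) \<subseteq> ?P"
    by blast
  moreover have fin: "finite ?P"
    using Suc finite_E by auto
  moreover have "card ?P \<le> card E * D ^ Suc n"
  proof -
    have "card ?P \<le> (\<Sum>xs\<in>adj_paths (Suc n). card ((\<lambda>g. xs @ [g]) ` {g\<in>E. adj (last xs) g}))"
      using Suc by (intro card_UN_le) auto
    also have "\<dots> \<le> (\<Sum>xs\<in>adj_paths (Suc n). D)"
    proof (rule sum_mono)
      fix xs assume xs: "xs \<in> adj_paths (Suc n)"
      then have "xs \<noteq> []" "set xs \<subseteq> E"
        using nearby_subset by (auto simp: adj_paths_def)
      then have "last xs \<in> E"
        using last_in_set by blast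
      then show "card ((\<lambda>g. xs @ [g]) ` {g\<in>E. adj (last xs) g}) \<le> D"
        using finite_E by (intro order.trans[OF card_image_le degree]) auto
    qed
    also have "\<dots> \<le> card E * D ^ Suc n"
      using Suc by (simp add: mult.commute mult.left_commute)
    finally show ?thesis .
  qed
  ultimately show ?case
    by (meson card_mono finite_subset order.trans)
qed

text \<open>
  A union bound over the blocks and over the paths supplied by \<open>pivotal_trace\<close>.
\<close>

lemma pivotal_rare:
  assumes e: "e \<in> E" "\<delta> e = 0" and r_pos: "0 < r" and l: "1 \<le> l" "2 * real l * real K < r" and j: "j < K * card E"
  shows "inner_prod (\<lambda>w. of_bool (far_blocked w)) ((avg E ^^ j) (\<lambda>w. of_bool (conn (w(e := True)))))
    \<le> ennreal (real K * real (card E) * (2 * real D * (1 - p)) ^ l)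
        * inner_prod (\<lambda>_. 1) (\<lambda>w. of_bool (far_blocked w))"
proof -
  let ?M = "card E"
  let ?PA = "\<integral>\<^sup>+w. of_bool (far_blocked w) \<partial>percolation"
  have PA: "inner_prod (\<lambda>_. 1) (\<lambda>w. of_bool (far_blocked w)) = ?PA"
    unfolding inner_prod_def by (intro nn_integral_cong) (use far_blocked_imp in auto)
  have fin: "finite (adj_paths l)" and card_le: "card (adj_paths l) \<le> ?M * D ^ l"
  proof -
    obtain n where n: "l = Suc n"
      using l(1) by (cases l) auto
    show "finite (adj_paths l)"
      using card_adj_paths n by blast
    have "?M * D ^ n \<le> ?M * D ^ l"
      using D_pos n by (intro mult_left_mono power_increasing) auto
    moreover have "card (adj_paths l) \<le> ?M * D ^ n"
      using card_adj_paths[of n] n by simp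
    ultimately show "card (adj_paths l) \<le> ?M * D ^ l"
      by (rule order.trans[rotated])
  qed
  have block: "j div ?M < K"
    using j by (simp add: less_mult_imp_div_less)
  have union: "of_bool (far_blocked w) * of_bool (conn ((run ns w)(e := True)))
      \<le> (\<Sum>i\<le>j div ?M. \<Sum>xs\<in>adj_paths l. of_bool (far_blocked w) * of_bool (set xs \<subseteq> closed_in_block w ns i) :: ennreal)"
    if len: "length ns = j" for w ns
  proof (cases "far_blocked w \<and> conn ((run ns w)(e := True))")
    case True
    have "\<exists>i\<le>j div ?M. \<exists>xs\<in>adj_paths l. set xs \<subseteq> closed_in_block w ns i"
    proof (rule ccontr)
      assume "\<not> ?thesis"
      then have no: "\<not> set xs \<subseteq> closed_in_block w ns i" if "i \<le> length ns div ?M" "xs \<in> adj_paths l" for i xs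
        using that len by blast
      have "e \<in> nearby"
        using e r_pos by (simp add: nearby_def)
      then have "r \<le> 2 * real l * (real (j div ?M) + 1)"
        using pivotal_trace[OF _ no, where f = e] True far_blocked_imp e(2) len by auto
      also have "\<dots> \<le> 2 * real l * real K"
        using block by (intro mult_left_mono) auto
      finally show False
        using l(2) by simp
    qed
    then obtain i xs where i: "i \<le> j div ?M" "xs \<in> adj_paths l" "set xs \<subseteq> closed_in_block w ns i"
      by blast
    have "of_bool (far_blocked w) * of_bool (set xs \<subseteq> closed_in_block w ns i)
        \<le> (\<Sum>xs\<in>adj_paths l. of_bool (far_blocked w) * of_bool (set xs \<subseteq> closed_in_block w ns i) :: ennreal)"
      by (rule member_le_sum[OF i(2) _ fin]) simp
    also have "\<dots> \<le> (\<Sum>i\<le>j div ?M. \<Sum>xs\<in>adj_paths l. of_bool (far_blocked w) * of_bool (set xs \<subseteq> closed_in_block w ns i))"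
      by (rule member_le_sum[of i "{..j div ?M}" "\<lambda>i. \<Sum>xs\<in>adj_paths l. of_bool (far_blocked w) * of_bool (set xs \<subseteq> closed_in_block w ns i) :: ennreal"])
         (use i(1) in auto)
    finally show ?thesis
      using True i(3) by simp
  qed auto
  have "inner_prod (\<lambda>w. of_bool (far_blocked w)) ((avg E ^^ j) (\<lambda>w. of_bool (conn (w(e := True)))))
      \<le> (\<integral>\<^sup>+w. \<integral>\<^sup>+ns. of_bool (far_blocked w) * of_bool (conn ((run ns w)(e := True))) \<partial>replicate_pmf j noise \<partial>percolation)"
    unfolding inner_prod_def avg_E_power by (intro nn_integral_mono) (simp add: nn_integral_cmult)
  also have "\<dots> \<le> (\<integral>\<^sup>+w. \<integral>\<^sup>+ns. (\<Sum>i\<le>j div ?M. \<Sum>xs\<in>adj_paths l.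
      of_bool (far_blocked w) * of_bool (set xs \<subseteq> closed_in_block w ns i)) \<partial>replicate_pmf j noise \<partial>percolation)"
    by (rule nn_integral_mono, rule nn_integral_mono_AE, rule AE_pmfI, rule union) (simp add: set_replicate_pmf)
  also have "\<dots> = (\<Sum>i\<le>j div ?M. \<Sum>xs\<in>adj_paths l. \<integral>\<^sup>+w. of_bool (far_blocked w)
      * (\<integral>\<^sup>+ns. of_bool (set xs \<subseteq> closed_in_block w ns i) \<partial>replicate_pmf j noise) \<partial>percolation)"
    by (simp add: nn_integral_sum nn_integral_cmult)
  also have "\<dots> \<le> (\<Sum>i\<le>j div ?M. \<Sum>xs\<in>adj_paths l. ennreal (2 * (1 - p)) ^ l * ?PA)"
  proof (intro sum_mono)
    fix i xs assume i: "i \<in> {..j div ?M}" and xs: "xs \<in> adj_paths l"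
    have "i * ?M \<le> j"
      using i by (metis atMost_iff div_times_less_eq_dividend le_trans mult_le_mono1)
    moreover have "card (set xs) = l" "set xs \<subseteq> nearby"
      using xs by (auto simp: adj_paths_def distinct_card)
    ultimately show "(\<integral>\<^sup>+w. of_bool (far_blocked w)
        * (\<integral>\<^sup>+ns. of_bool (set xs \<subseteq> closed_in_block w ns i) \<partial>replicate_pmf j noise) \<partial>percolation)
        \<le> ennreal (2 * (1 - p)) ^ l * ?PA"
      using closed_in_block_bound[of "set xs" i j] by simp
  qed
  also have "\<dots> = ennreal (real (j div ?M + 1) * real (card (adj_paths l)) * (2 * (1 - p)) ^ l) * ?PA"
    using p_less by (simp add: ennreal_mult ennreal_power ennreal_of_nat_eq_real_of_nat mult.assoc
      ennreal_plus[symmetric] del: ennreal_plus)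
  also have "\<dots> \<le> ennreal (real K * real (?M * D ^ l) * (2 * (1 - p)) ^ l) * ?PA"
    using block card_le p_less
    by (intro mult_right_mono ennreal_leI mult_mono of_nat_mono) auto
  also have "real K * real (?M * D ^ l) * (2 * (1 - p)) ^ l = real K * real ?M * (2 * real D * (1 - p)) ^ l"
    by (simp only: power_mult_distrib of_nat_mult of_nat_power mult_ac)
  finally show ?thesis
    unfolding PA .
qed

text \<open>
  Take \<open>K\<close> blocks in \<open>disagreement_bound\<close>: the probability that \<open>e\<close> is not chosen during
  \<open>K * card E\<close> steps is at most \<open>exp (- K)\<close>.
\<close>

lemma disagreement_far_from_blocking:
  assumes supp: "snd ` set_pmf \<mu> \<subseteq> blocked_configs"
    and stationary: "bind_pmf \<mu> (\<lambda>(x, y). map_pmf (\<lambda>z. (x(fst z := snd z), step z y)) noise) = \<mu>"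
    and e: "e \<in> E" "\<delta> e = 0" and r_pos: "0 < r" and l: "1 \<le> l" "2 * real l * real K < r"
  shows "measure \<mu> {s. fst s e \<noteq> snd s e \<and> far_blocked (snd s)}
    \<le> ((real K)\<^sup>2 * real (card E) * (2 * real D * (1 - p)) ^ l + exp (- real K))
      * measure \<mu> {s. far_blocked (snd s)}"
proof -
  let ?M = "card E"
  define a where "a = real K * real ?M * (2 * real D * (1 - p)) ^ l"
  have M: "0 < ?M"
    using finite_E nonempty_E by (simp add: card_gt_0_iff)
  have a_nonneg: "0 \<le> a"
    using p_less by (simp add: a_def)
  have integral: "(\<integral>\<^sup>+s. of_bool (P s) \<partial>\<mu>) = ennreal (measure \<mu> {s. P s})" for P
  proof -
    have "(\<integral>\<^sup>+s. of_bool (P s) \<partial>\<mu>) = (\<integral>\<^sup>+s. indicator {s. P s} s \<partial>\<mu>)"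
      by (intro nn_integral_cong) (simp add: indicator_def)
    then show ?thesis
      by (simp add: measure_pmf.emeasure_eq_measure)
  qed
  have decay: "((real ?M - 1) / real ?M) ^ (K * ?M) \<le> exp (- real K)"
  proof -
    have "(real ?M - 1) / real ?M = 1 + (- 1 / real ?M)"
      using M by (simp add: diff_divide_distrib)
    also have "\<dots> \<le> exp (- 1 / real ?M)"
      by (rule exp_ge_add_one_self)
    finally have "((real ?M - 1) / real ?M) ^ (K * ?M) \<le> exp (- 1 / real ?M) ^ (K * ?M)"
      using M by (intro power_mono) auto
    also have "\<dots> = exp (- real K)"
      using M by (simp add: exp_of_nat_mult[symmetric])
    finally show ?thesis .
  qed
  have "ennreal (measure \<mu> {s. fst s e \<noteq> snd s e \<and> far_blocked (snd s)})
      \<le> (of_nat (K * ?M) * ennreal a / of_nat ?M + ennreal ((real ?M - 1) / real ?M) ^ (K * ?M))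
        * ennreal (measure \<mu> {s. far_blocked (snd s)})"
    unfolding integral[symmetric]
    by (rule disagreement_bound[OF supp stationary e(1)])
       (unfold a_def, rule pivotal_rare[OF e r_pos l])
  also have "of_nat (K * ?M) * ennreal a / of_nat ?M = ennreal (real K * a)"
    using M a_nonneg by (simp add: ennreal_of_nat_eq_real_of_nat ennreal_mult[symmetric] divide_ennreal)
  also have "ennreal ((real ?M - 1) / real ?M) ^ (K * ?M) = ennreal (((real ?M - 1) / real ?M) ^ (K * ?M))"
    using M by (intro ennreal_power) auto
  also have "(ennreal (real K * a) + ennreal (((real ?M - 1) / real ?M) ^ (K * ?M))) * ennreal (measure \<mu> {s. far_blocked (snd s)})
      = ennreal ((real K * a + ((real ?M - 1) / real ?M) ^ (K * ?M)) * measure \<mu> {s. far_blocked (snd s)})"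
    using M a_nonneg by (subst ennreal_plus[symmetric], simp, simp, subst ennreal_mult) auto
  finally have "measure \<mu> {s. fst s e \<noteq> snd s e \<and> far_blocked (snd s)}
      \<le> (real K * a + ((real ?M - 1) / real ?M) ^ (K * ?M)) * measure \<mu> {s. far_blocked (snd s)}"
    using M a_nonneg by (subst (asm) ennreal_le_iff) auto
  also have "\<dots> \<le> (real K * a + exp (- real K)) * measure \<mu> {s. far_blocked (snd s)}"
    using decay by (intro mult_right_mono add_left_mono) auto
  finally show ?thesis
    by (simp add: a_def power2_eq_square mult.assoc)
qed

end

section \<open>The lattice in integer coordinates\<close>

definition emb :: "('d::finite \<Rightarrow> int) \<Rightarrow> real^'d" where
  "emb z = (\<chi> i. real_of_int (z i))"

definition int_box :: "nat \<Rightarrow> ('d \<Rightarrow> int) set" where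
  "int_box n = {z. \<forall>k. \<bar>z k\<bar> \<le> int n}"

definition up :: "('d \<Rightarrow> int) \<Rightarrow> 'd \<Rightarrow> 'd \<Rightarrow> int" where
  "up z i = z(i := z i + 1)"

definition edge :: "('d::finite \<Rightarrow> int) \<Rightarrow> 'd \<Rightarrow> (real^'d) set" where
  "edge z i = {emb z, emb (up z i)}"

lemma emb_nth [simp]: "emb z $ i = real_of_int (z i)"
  by (simp add: emb_def)

lemma emb_inject [simp]: "emb z = emb z' \<longleftrightarrow> z = z'"
  by (auto simp: vec_eq_iff)

lemma lattice_eq: "lattice = range emb"
proof -
  have "x \<in> range emb" if "x \<in> lattice" for x :: "real^'d"
  proof -
    have "x = emb (\<lambda>i. \<lfloor>x $ i\<rfloor>)"
      using that by (simp add: vec_eq_iff lattice_def)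
    then show ?thesis by blast
  qed
  then show ?thesis
    by (auto simp: lattice_def)
qed

lemma emb_in_lattice [simp]: "emb z \<in> lattice"
  by (simp add: lattice_eq)

lemma emb_in_cube [simp]: "emb z \<in> cube n \<longleftrightarrow> z \<in> int_box n"
proof -
  have "(- real n \<le> real_of_int k \<and> real_of_int k \<le> real n) \<longleftrightarrow> \<bar>k\<bar> \<le> int n" for k
    by linarith
  then show ?thesis
    by (simp add: cube_def int_box_def mem_box_cart)
qed

lemma convex_cube: "convex (cube n)"
  by (simp add: cube_def convex_box)

lemma segment_subset_cube: "segment e \<subseteq> cube n \<longleftrightarrow> e \<subseteq> cube n"
  unfolding segment_def by (meson convex_cube hull_minimal hull_subset order.trans)

lemma finite_int_box: "finite (int_box n :: ('d::finite \<Rightarrow> int) set)"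
proof -
  have "int_box n \<subseteq> (UNIV \<rightarrow>\<^sub>E {- int n..int n} :: ('d \<Rightarrow> int) set)"
    by (auto simp: int_box_def abs_le_iff minus_le_iff)
  then show ?thesis
    by (rule finite_subset) (simp add: finite_PiE)
qed

lemma dist_emb: "dist (emb a) (emb b) = 1 \<longleftrightarrow> (\<exists>i. b = up a i \<or> a = up b i)"
proof
  assume "dist (emb a) (emb b) = 1"
  then have "(\<Sum>i\<in>UNIV. (real_of_int (a i - b i))\<^sup>2) = 1"
    by (simp add: dist_vec_def L2_set_def dist_real_def)
  then have sum: "(\<Sum>i\<in>UNIV. (a i - b i)\<^sup>2) = 1"
    by (metis (mono_tags, lifting) of_int_eq_1_iff of_int_power of_int_sum sum.cong)
  then obtain i where i: "a i \<noteq> b i"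
    by (metis (mono_tags, lifting) power_zero_numeral diff_self sum.neutral zero_neq_one)
  have "(a i - b i)\<^sup>2 + (\<Sum>k\<in>UNIV - {i}. (a k - b k)\<^sup>2) = 1"
    using sum by (simp add: sum.remove[of UNIV i])
  moreover have "1 \<le> (a i - b i)\<^sup>2"
    using i by (simp add: int_one_le_iff_zero_less)
  moreover have "0 \<le> (\<Sum>k\<in>UNIV - {i}. (a k - b k)\<^sup>2)"
    by (simp add: sum_nonneg)
  ultimately have 1: "(a i - b i)\<^sup>2 = 1" and 2: "(\<Sum>k\<in>UNIV - {i}. (a k - b k)\<^sup>2) = 0"
    by linarith+
  from 2 have "\<forall>k\<in>UNIV - {i}. (a k - b k)\<^sup>2 = 0"
    by (subst (asm) sum_nonneg_eq_0_iff) auto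
  then have eq: "a k = b k" if "k \<noteq> i" for k
    using that by simp
  from 1 have "a i - b i = 1 \<or> a i - b i = - 1"
    by (simp add: power2_eq_1_iff)
  then have "a i = b i + 1 \<or> b i = a i + 1"
    by linarith
  then show "\<exists>i. b = up a i \<or> a = up b i"
    using eq by (intro exI[of _ i]) (auto simp: up_def fun_eq_iff)
next
  have *: "dist (emb a) (emb (up a i)) = 1" for a :: "'a \<Rightarrow> int" and i
  proof -
    have "(\<Sum>k\<in>UNIV. (dist (emb a $ k) (emb (up a i) $ k))\<^sup>2) = (\<Sum>k\<in>UNIV. if k = i then 1 else 0)"
      by (intro sum.cong) (auto simp: up_def dist_real_def)
    then show ?thesis
      by (simp add: dist_vec_def L2_set_def)
  qed
  assume "\<exists>i. b = up a i \<or> a = up b i"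
  then show "dist (emb a) (emb b) = 1"
    using * by (auto simp: dist_commute)
qed

lemma edges_eq: "edges n = {edge z i :: (real^'d::finite) set | z i. z \<in> int_box n \<and> up z i \<in> int_box n}"
proof (intro equalityI subsetI)
  fix e :: "(real^'d) set" assume "e \<in> edges n"
  then obtain x y where xy: "e = {x, y}" "x \<in> lattice" "y \<in> lattice" "dist x y = 1" "e \<subseteq> cube n"
    unfolding edges_def lattice_edges_def segment_subset_cube by blast
  then obtain a b where ab: "x = emb a" "y = emb b"
    unfolding lattice_eq by blast
  then have box: "a \<in> int_box n" "b \<in> int_box n"
    using xy by auto
  obtain i where "b = up a i \<or> a = up b i"
    using xy(4) unfolding ab dist_emb by blast
  then have "e = edge a i \<and> up a i \<in> int_box n \<or> e = edge b i \<and> up b i \<in> int_box n"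
    using xy(1) ab box by (auto simp: edge_def)
  then show "e \<in> {edge z i | z i. z \<in> int_box n \<and> up z i \<in> int_box n}"
    using box by blast
next
  fix e :: "(real^'d) set" assume "e \<in> {edge z i | z i. z \<in> int_box n \<and> up z i \<in> int_box n}"
  then obtain z i where z: "e = edge z i" "z \<in> int_box n" "up z i \<in> int_box n"
    by blast
  then have "e \<subseteq> cube n" "dist (emb z) (emb (up z i)) = 1"
    by (simp_all add: edge_def dist_emb) blast
  then show "e \<in> edges n"
    unfolding edges_def lattice_edges_def segment_subset_cube z(1) edge_def mem_Collect_eq
    using emb_in_lattice by blast
qed

lemma finite_edges: "finite (edges n :: (real^'d::finite) set set)"
proof -
  have "edges n \<subseteq> (\<lambda>(z, i). edge z i) ` (int_box n \<times> (UNIV :: 'd set))"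
    by (auto simp: edges_eq)
  then show ?thesis
    by (rule finite_subset) (simp add: finite_int_box)
qed

lemma cube_size_eq: "cube_size TYPE('d::finite) n = card (int_box n :: ('d \<Rightarrow> int) set)"
proof -
  have "cube n \<inter> lattice = emb ` (int_box n :: ('d \<Rightarrow> int) set)"
    by (auto simp: lattice_eq)
  then show ?thesis
    by (simp add: cube_size_def card_image inj_on_def)
qed

lemma card_edges_le: "card (edges n :: (real^'d::finite) set set) \<le> (cube_size TYPE('d) n)\<^sup>2"
proof -
  let ?X = "int_box n \<times> int_box n :: (('d \<Rightarrow> int) \<times> ('d \<Rightarrow> int)) set"
  have fin: "finite ?X"
    by (simp add: finite_int_box)
  have "e \<in> (\<lambda>(a, b). {emb a, emb b}) ` ?X" if "e \<in> edges n" for e :: "(real^'d) set"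
    using that by (auto simp: edges_eq edge_def)
  then have "(edges n :: (real^'d) set set) \<subseteq> (\<lambda>(a, b). {emb a, emb b}) ` ?X"
    by blast
  with fin have "card (edges n :: (real^'d) set set) \<le> card ?X"
    by (rule surj_card_le)
  then show ?thesis
    by (simp add: cube_size_eq card_cartesian_product power2_eq_square)
qed

lemma edges_nonempty: "1 \<le> n \<Longrightarrow> edges n \<noteq> ({} :: (real^'d::finite) set set)"
proof -
  assume "1 \<le> n"
  then have "(\<lambda>_. 0) \<in> int_box n" "up (\<lambda>_. 0) i \<in> int_box n" for i :: 'd
    by (auto simp: int_box_def up_def)
  then have "edge (\<lambda>_. 0) i \<in> edges n" for i :: 'd
    unfolding edges_eq by blast
  then show ?thesis by blast
qed

lemma int_box_bounds: "z \<in> int_box n \<Longrightarrow> - int n \<le> z k" "z \<in> int_box n \<Longrightarrow> z k \<le> int n"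
  by (auto simp: int_box_def abs_le_iff minus_le_iff dest: spec[of _ k])

lemma upd_in_int_box: "z \<in> int_box n \<Longrightarrow> z(i := k) \<in> int_box n \<longleftrightarrow> - int n \<le> k \<and> k \<le> int n"
  using int_box_bounds[of "z(i := k)" n i] by (auto simp: int_box_def)

lemma up_in_int_box: "z \<in> int_box n \<Longrightarrow> up z i \<in> int_box n \<longleftrightarrow> z i < int n"
  using int_box_bounds(1)[of z n i] by (auto simp: up_def upd_in_int_box)

section \<open>Connectedness of minimal cuts\<close>

text \<open>
  A Poincare lemma modulo 2: if \<open>\<sigma>\<close> has even sum around every unit square of the box, it is the
  coboundary of a function \<open>\<phi>\<close>. The directions are treated one after the other. When direction \<open>i\<close> is
  added, subtracting the coboundary found so far leaves \<open>\<tau>\<close>, which vanishes along the old directions.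
  The sum \<open>h\<close> of \<open>\<tau>\<close> along direction \<open>i\<close>, starting at the face of the box, corrects \<open>\<phi>\<close>; it is constant
  along the old directions, since \<open>\<tau>\<close> takes the same value on opposite sides of a square that has its
  two other sides in an old direction.
\<close>

lemma potential_exists:
  fixes \<sigma> :: "('d \<Rightarrow> int) \<Rightarrow> 'd \<Rightarrow> bool"
  assumes "finite J"
    and flat: "\<And>z i j. i \<noteq> j \<Longrightarrow> z \<in> int_box n \<Longrightarrow> up z i \<in> int_box n \<Longrightarrow> up z j \<in> int_box n \<Longrightarrow>
      (\<sigma> z i \<noteq> \<sigma> (up z j) i) = (\<sigma> z j \<noteq> \<sigma> (up z i) j)"
  shows "\<exists>\<phi> :: ('d \<Rightarrow> int) \<Rightarrow> bool. \<forall>z\<in>int_box n. \<forall>i\<in>J. up z i \<in> int_box n \<longrightarrow> \<sigma> z i = (\<phi> z \<noteq> \<phi> (up z i))"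
  using assms(1)
proof (induction J rule: finite_induct)
  case (insert i J)
  from insert.IH obtain \<phi> :: "('d \<Rightarrow> int) \<Rightarrow> bool" where "\<forall>z\<in>int_box n. \<forall>i\<in>J. up z i \<in> int_box n \<longrightarrow> \<sigma> z i = (\<phi> z \<noteq> \<phi> (up z i))" ..
  then have \<phi>: "\<And>z j. z \<in> int_box n \<Longrightarrow> j \<in> J \<Longrightarrow> up z j \<in> int_box n \<Longrightarrow> \<sigma> z j = (\<phi> z \<noteq> \<phi> (up z j))"
    by blast
  define \<tau> where "\<tau> z k = (\<sigma> z k \<noteq> (\<phi> z \<noteq> \<phi> (up z k)))" for z k
  define h where "h z = odd (card {k\<in>{- int n..<z i}. \<tau> (z(i := k)) i})" for z
  have up_comm: "up (up z j) k = up (up z k) j" if "j \<noteq> k" for z :: "'d \<Rightarrow> int" and j k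
    using that by (simp add: up_def fun_upd_twist)
  have along: "\<tau> z i = (h z \<noteq> h (up z i))" if z: "z \<in> int_box n" "up z i \<in> int_box n" for z
  proof -
    let ?K = "{k\<in>{- int n..<z i}. \<tau> (z(i := k)) i}"
    have "- int n \<le> z i"
      using z(1) by (rule int_box_bounds)
    then have "{- int n..<z i + 1} = insert (z i) {- int n..<z i}"
      by auto
    then have "{k\<in>{- int n..<up z i i}. \<tau> ((up z i)(i := k)) i} = (if \<tau> z i then insert (z i) ?K else ?K)"
      by (auto simp: up_def)
    moreover have "z i \<notin> ?K" "finite ?K"
      by (auto intro: finite_subset[of _ "{- int n..<z i}"])
    ultimately show ?thesis
      by (simp add: h_def)
  qed
  have across: "h (up z j) = h z" if z: "z \<in> int_box n" "up z j \<in> int_box n" and j: "j \<in> J" for z j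
  proof -
    have "j \<noteq> i"
      using j insert.hyps by blast
    have "\<tau> ((up z j)(i := k)) i = \<tau> (z(i := k)) i" if k: "k \<in> {- int n..<z i}" for k
    proof -
      let ?w = "z(i := k)"
      have w: "?w \<in> int_box n" "up ?w j \<in> int_box n" "up ?w i \<in> int_box n" "up (up ?w i) j \<in> int_box n"
      proof -
        have "z j < int n" "z i \<le> int n"
          using z int_box_bounds[OF z(1), of i] by (simp_all add: up_in_int_box)
        then show "?w \<in> int_box n" "up ?w j \<in> int_box n" "up ?w i \<in> int_box n" "up (up ?w i) j \<in> int_box n"
          using z(1) k \<open>j \<noteq> i\<close> by (auto simp: upd_in_int_box up_in_int_box up_def[of _ i])
      qed
      have "\<not> \<tau> ?w j" "\<not> \<tau> (up ?w i) j"
        using \<phi> w j by (auto simp: \<tau>_def)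
      moreover have "(\<sigma> ?w i \<noteq> \<sigma> (up ?w j) i) = (\<sigma> ?w j \<noteq> \<sigma> (up ?w i) j)"
        using flat[of i j ?w] \<open>j \<noteq> i\<close> w by blast
      ultimately have "\<tau> ?w i = \<tau> (up ?w j) i"
        using up_comm[of i j ?w] \<open>j \<noteq> i\<close> unfolding \<tau>_def by auto
      moreover have "(up z j)(i := k) = up ?w j"
        using \<open>j \<noteq> i\<close> by (simp add: up_def fun_upd_twist)
      ultimately show ?thesis
        by simp
    qed
    then have "{k\<in>{- int n..<z i}. \<tau> ((up z j)(i := k)) i} = {k\<in>{- int n..<z i}. \<tau> (z(i := k)) i}"
      by blast
    moreover have "up z j i = z i"
      using \<open>j \<noteq> i\<close> by (simp add: up_def)
    ultimately show ?thesis
      by (simp add: h_def)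
  qed
  have "\<forall>z\<in>int_box n. \<forall>j\<in>insert i J. up z j \<in> int_box n \<longrightarrow>
      \<sigma> z j = ((\<phi> z \<noteq> h z) \<noteq> (\<phi> (up z j) \<noteq> h (up z j)))"
    using along across \<phi> unfolding \<tau>_def by auto
  then show ?case
    by (rule exI[of _ "\<lambda>z. \<phi> z \<noteq> h z"])
qed simp

text \<open>
  Two points of a face are joined inside it by changing one coordinate at a time; \<open>J\<close> is the set of
  the coordinates still to be changed.
\<close>

lemma constant_on_face:
  fixes \<phi> :: "('d \<Rightarrow> int) \<Rightarrow> bool"
  assumes "finite J" "v \<notin> J"
    and inv: "\<And>z i. z \<in> int_box n \<Longrightarrow> z v = h \<Longrightarrow> i \<noteq> v \<Longrightarrow> up z i \<in> int_box n \<Longrightarrow> \<phi> (up z i) = \<phi> z"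
    and z: "z \<in> int_box n" "z v = h" "z' \<in> int_box n" "\<And>k. k \<notin> J \<Longrightarrow> z' k = z k"
  shows "\<phi> z' = \<phi> z"
  using assms(1,2) z
proof (induction J arbitrary: z rule: finite_induct)
  case empty
  then have "z' = z" by auto
  then show ?case by simp
next
  case (insert i J)
  have i: "i \<noteq> v"
    using insert.prems by auto
  have line: "\<phi> (z(i := k)) = \<phi> (z(i := - int n))" if "- int n \<le> k" "k \<le> int n" for k
    using that
  proof (induction k rule: int_ge_induct)
    case (step k)
    have "z(i := k) \<in> int_box n" "up (z(i := k)) i \<in> int_box n"
      using insert.prems(2) step by (auto simp: int_box_def up_def)
    then have "\<phi> (up (z(i := k)) i) = \<phi> (z(i := k))"
      using inv[of "z(i := k)" i] insert.prems i by simp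
    moreover have "up (z(i := k)) i = z(i := k + 1)"
      by (simp add: up_def)
    moreover have "\<phi> (z(i := k)) = \<phi> (z(i := - int n))"
      by (rule step.IH) (use step in simp_all)
    ultimately show ?case
      by (simp only:)
  qed simp
  let ?y = "z(i := z' i)"
  have y: "?y \<in> int_box n" "?y v = h" "\<And>k. k \<notin> J \<Longrightarrow> z' k = ?y k"
    using insert.prems i by (auto simp: int_box_def)
  have "\<phi> z' = \<phi> ?y"
    by (rule insert.IH[OF _ y(1,2) _ y(3)]) (use insert.prems in auto)
  also have "\<dots> = \<phi> (z(i := z i))"
    using line[of "z' i", OF int_box_bounds[of z' n i]] line[of "z i", OF int_box_bounds[of z n i]] insert.prems
    by simp
  finally show ?case
    by simp
qed

lemma path_edges_Cons_Cons: "path_edges (x # y # xs) = insert {x, y} (path_edges (y # xs))"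
proof -
  have "{i. Suc i < length (x # y # xs)} = insert 0 (Suc ` {i. Suc i < length (y # xs)})"
    by (auto simp: image_iff less_Suc_eq_0_disj)
  moreover have "path_edges zs = (\<lambda>i. {zs ! i, zs ! Suc i}) ` {i. Suc i < length zs}" for zs :: "(real^'a) list"
    by (auto simp: path_edges_def)
  ultimately show ?thesis
    by (simp add: image_image)
qed

lemma path_edges_singleton [simp]: "path_edges [x] = {}"
  by (simp add: path_edges_def)

lemma path_edges_snoc: "xs \<noteq> [] \<Longrightarrow> path_edges (xs @ [y]) = insert {last xs, y} (path_edges xs)"
proof (induction xs)
  case (Cons x xs)
  then show ?case
    by (cases xs) (auto simp: path_edges_Cons_Cons)
qed simp

lemma constant_along_path:
  assumes "xs \<noteq> []" "\<And>x y. {x, y} \<in> path_edges xs \<Longrightarrow> \<phi> x = \<phi> y"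
  shows "\<phi> (hd xs) = \<phi> (last xs)"
  using assms
proof (induction xs)
  case (Cons x xs)
  show ?case
  proof (cases xs)
    case (Cons y ys)
    then have "\<phi> x = \<phi> y"
      using Cons.prems(2) by (simp add: path_edges_Cons_Cons)
    moreover have "\<phi> (hd xs) = \<phi> (last xs)"
      using Cons.IH Cons.prems(2) \<open>xs = y # ys\<close> by (simp add: path_edges_Cons_Cons)
    ultimately show ?thesis
      using \<open>xs = y # ys\<close> by simp
  qed simp
qed simp

text \<open>
  \<open>A\<close> holds at the points that are connected to the top without crossing \<open>C\<close>. If \<open>A\<close> took the same value
  at both ends of an edge of \<open>C\<close>, it would be constant along a path from top to bottom that meets \<open>C\<close>
  in this edge only, and such a path exists by minimality.
\<close>

lemma cut_sides:
  assumes "is_cut v n C"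
  obtains A where "\<And>x. x \<in> top_face v n \<inter> lattice \<Longrightarrow> A x" "\<And>x. x \<in> bottom_face v n \<inter> lattice \<Longrightarrow> \<not> A x"
    "\<And>x y. {x, y} \<in> edges n \<Longrightarrow> {x, y} \<in> C \<longleftrightarrow> A x \<noteq> A y"
proof -
  have sep: "C \<subseteq> edges n" "\<And>xs. top_bottom_path v n xs \<Longrightarrow> path_edges xs \<inter> C \<noteq> {}"
    using assms by (auto simp: is_cut_def separates_def)
  define A where "A x \<longleftrightarrow> (\<exists>xs. xs \<noteq> [] \<and> hd xs \<in> top_face v n \<inter> lattice \<and> last xs = x
      \<and> path_edges xs \<subseteq> edges n - C)" for x
  have top: "A x" if "x \<in> top_face v n \<inter> lattice" for x
    unfolding A_def using that by (intro exI[of _ "[x]"]) simp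
  have bottom: "\<not> A x" if x: "x \<in> bottom_face v n \<inter> lattice" for x
  proof
    assume "A x"
    then obtain xs where "top_bottom_path v n xs" "path_edges xs \<inter> C = {}"
      unfolding A_def top_bottom_path_def using x by blast
    then show False
      using sep(2) by blast
  qed
  have extend: "A y" if Ax: "A x" and xy: "{x, y} \<in> edges n - C" for x y
  proof -
    obtain xs where "xs \<noteq> []" "hd xs \<in> top_face v n \<inter> lattice" "last xs = x" "path_edges xs \<subseteq> edges n - C"
      using Ax unfolding A_def by blast
    then have "xs @ [y] \<noteq> [] \<and> hd (xs @ [y]) \<in> top_face v n \<inter> lattice \<and> last (xs @ [y]) = y
        \<and> path_edges (xs @ [y]) \<subseteq> edges n - C"
      using xy by (simp add: path_edges_snoc)
    then show ?thesis
      unfolding A_def by blast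
  qed
  have outside: "A x = A y" if "{x, y} \<in> edges n" "{x, y} \<notin> C" for x y
    using extend[of x y] extend[of y x] that by (auto simp: insert_commute)
  have inside: "A x \<noteq> A y" if xy: "{x, y} \<in> C" for x y
  proof
    assume eq: "A x = A y"
    have "C - {{x, y}} \<subset> C"
      using xy by blast
    then have "\<not> separates v n (C - {{x, y}})"
      using assms by (simp add: is_cut_def)
    then obtain xs where xs: "top_bottom_path v n xs" "path_edges xs \<inter> (C - {{x, y}}) = {}"
      using sep(1) by (auto simp: separates_def)
    have "A (hd xs) = A (last xs)"
    proof (rule constant_along_path)
      show "xs \<noteq> []"
        using xs(1) by (simp add: top_bottom_path_def)
      fix a b assume ab: "{a, b} \<in> path_edges xs"
      then have "{a, b} \<in> edges n"
        using xs(1) by (auto simp: top_bottom_path_def)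
      have "{a, b} = {x, y}" if "{a, b} \<in> C"
        using that xs(2) ab by blast
      then show "A a = A b"
        using outside[OF \<open>{a, b} \<in> edges n\<close>] eq unfolding doubleton_eq_iff by metis
    qed
    then show False
      using top bottom xs(1) by (auto simp: top_bottom_path_def)
  qed
  show thesis
  proof (rule that)
    show "{x, y} \<in> C \<longleftrightarrow> A x \<noteq> A y" if "{x, y} \<in> edges n" for x y
      using inside outside that by blast
  qed (fact top bottom)+
qed

text \<open>
  A relation of bounded degree that holds between any two edges of the same unit square.
\<close>

definition near :: "(real^'d) set \<Rightarrow> (real^'d) set \<Rightarrow> bool" where
  "near f g \<longleftrightarrow> (\<forall>x\<in>f. \<forall>y\<in>g. dist x y \<le> 2)"

lemma dist_square:
  assumes "i \<noteq> j" "a \<in> {z, up z i, up z j, up (up z i) j}" "b \<in> {z, up z i, up z j, up (up z i) j}"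
  shows "dist (emb a) (emb b) \<le> 2"
proof -
  have *: "\<bar>(emb a - emb b) $ k\<bar> \<le> of_bool (k = i) + of_bool (k = j)" for k
    using assms by (auto simp: up_def)
  have "dist (emb a) (emb b) \<le> (\<Sum>k\<in>UNIV. \<bar>(emb a - emb b) $ k\<bar>)"
    unfolding dist_norm by (rule norm_le_l1_cart)
  also have "\<dots> \<le> (\<Sum>k\<in>UNIV. of_bool (k = i) + of_bool (k = j))"
    by (rule sum_mono) (rule *)
  also have "\<dots> = 2"
    by (simp add: sum.distrib)
  finally show ?thesis .
qed

lemma up_commute: "i \<noteq> j \<Longrightarrow> up (up z i) j = up (up z j) i"
  by (simp add: up_def fun_upd_twist)

lemma face_eq:
  "top_face v n \<inter> lattice = emb ` {z\<in>int_box n. z v = int n}"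
  "bottom_face v n \<inter> lattice = emb ` {z\<in>int_box n. z v = - int n}"
proof -
  have "real_of_int k = - real n \<longleftrightarrow> k = - int n" for k
    by linarith
  then show "top_face v n \<inter> lattice = emb ` {z\<in>int_box n. z v = int n}"
    "bottom_face v n \<inter> lattice = emb ` {z\<in>int_box n. z v = - int n}"
    by (auto simp: top_face_def bottom_face_def lattice_eq)
qed

text \<open>
  Otherwise \<open>C\<close> is the disjoint union of nonempty sets \<open>C1\<close> and \<open>C - C1\<close> such that no unit square meets
  both. Every unit square meets \<open>C\<close>, hence also \<open>C1\<close>, in an even number of edges, so \<open>C1\<close> consists of
  the edges across which some function \<open>\<psi>\<close> changes. By minimality of \<open>C\<close> there are two paths from top to
  bottom, one avoiding \<open>C1\<close> and the other avoiding \<open>C - C1\<close>. Along the first \<open>\<psi>\<close> is constant. Along the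
  second \<open>\<psi>\<close> changes exactly when the side \<open>A\<close> of the cut does, so that \<open>\<psi>\<close> takes different values at
  its ends. Since \<open>\<psi>\<close> is constant on the top face and on the bottom face, this is a contradiction.
\<close>

lemma cut_near_connected:
  fixes v :: "'d::finite"
  assumes cut: "is_cut v n C" and f: "f \<in> C" and g: "g \<in> C"
  shows "(f, g) \<in> {(a, b). a \<in> C \<and> b \<in> C \<and> near a b}\<^sup>*"
proof (rule ccontr)
  assume not_reach: "(f, g) \<notin> {(a, b). a \<in> C \<and> b \<in> C \<and> near a b}\<^sup>*"
  define C1 where "C1 = {a\<in>C. (f, a) \<in> {(a, b). a \<in> C \<and> b \<in> C \<and> near a b}\<^sup>*}"
  have C: "C \<subseteq> edges n" "\<And>S. S \<subset> C \<Longrightarrow> \<not> separates v n S"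
    using cut by (auto simp: is_cut_def separates_def)
  have near_closed: "b \<in> C1" if "a \<in> C1" "b \<in> C" "near a b" for a b
  proof -
    have "(a, b) \<in> {(a, b). a \<in> C \<and> b \<in> C \<and> near a b}"
      using that by (simp add: C1_def)
    then show ?thesis
      using that unfolding C1_def by (auto intro: rtrancl_into_rtrancl)
  qed
  obtain A where A: "\<And>x. x \<in> top_face v n \<inter> lattice \<Longrightarrow> A x" "\<And>x. x \<in> bottom_face v n \<inter> lattice \<Longrightarrow> \<not> A x"
    and A_edge: "\<And>x y. {x, y} \<in> edges n \<Longrightarrow> {x, y} \<in> C \<longleftrightarrow> A x \<noteq> A y"
    using cut_sides[OF cut] by blast
  have in_edges: "edge z i \<in> edges n" if "z \<in> int_box n" "up z i \<in> int_box n" for z i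
    using that by (auto simp: edges_eq)
  have edge_A: "edge z i \<in> C \<longleftrightarrow> A (emb z) \<noteq> A (emb (up z i))" if "z \<in> int_box n" "up z i \<in> int_box n" for z i
    using A_edge[of "emb z" "emb (up z i)"] in_edges[OF that] by (simp add: edge_def)
  have "\<exists>\<phi> :: ('d \<Rightarrow> int) \<Rightarrow> bool. \<forall>z\<in>int_box n. \<forall>i\<in>UNIV. up z i \<in> int_box n \<longrightarrow> (edge z i \<in> C1) = (\<phi> z \<noteq> \<phi> (up z i))"
  proof (rule potential_exists)
    fix z and i j :: 'd
    assume ij: "i \<noteq> j" and z: "z \<in> int_box n" "up z i \<in> int_box n" "up z j \<in> int_box n"
    have zij: "up (up z i) j \<in> int_box n"
    proof -
      have "up z i j = z j"
        using ij by (simp add: up_def)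
      then show ?thesis
        using z by (simp add: up_in_int_box)
    qed
    let ?S = "{edge z i, edge (up z j) i, edge z j, edge (up z i) j}"
    have S_near: "near a b" if ab: "a \<in> ?S" "b \<in> ?S" for a b
    proof -
      let ?V = "{z, up z i, up z j, up (up z i) j}"
      have "c \<subseteq> emb ` ?V" if "c \<in> ?S" for c
        using that up_commute[OF ij, of z] by (auto simp: edge_def)
      then have "a \<subseteq> emb ` ?V" "b \<subseteq> emb ` ?V"
        using ab by blast+
      then show ?thesis
        unfolding near_def using dist_square[OF ij, of _ z] by fast
    qed
    have all: "a \<in> C1 \<longleftrightarrow> a \<in> C" if "a \<in> ?S" "b \<in> ?S" "b \<in> C1" for a b
      using near_closed[OF that(3) _ S_near[OF that(2,1)]] by (auto simp: C1_def)
    show "((edge z i \<in> C1) \<noteq> (edge (up z j) i \<in> C1)) = ((edge z j \<in> C1) \<noteq> (edge (up z i) j \<in> C1))"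
    proof (cases "\<exists>b\<in>?S. b \<in> C1")
      case True
      then obtain b where b: "b \<in> ?S" "b \<in> C1"
        by blast
      have "edge z i \<in> C1 \<longleftrightarrow> edge z i \<in> C" "edge (up z j) i \<in> C1 \<longleftrightarrow> edge (up z j) i \<in> C"
          "edge z j \<in> C1 \<longleftrightarrow> edge z j \<in> C" "edge (up z i) j \<in> C1 \<longleftrightarrow> edge (up z i) j \<in> C"
        using all[OF _ b] by blast+
      then show ?thesis
        using z zij edge_A up_commute[OF ij, of z] by auto
    next
      case False
      then show ?thesis by blast
    qed
  qed simp
  then obtain \<phi> :: "('d \<Rightarrow> int) \<Rightarrow> bool" where \<phi>: "\<And>z i. z \<in> int_box n \<Longrightarrow> up z i \<in> int_box n \<Longrightarrow> (edge z i \<in> C1) = (\<phi> z \<noteq> \<phi> (up z i))"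
    by blast
  define \<psi> where "\<psi> x = \<phi> (\<lambda>i. \<lfloor>x $ i\<rfloor>)" for x :: "real^'d"
  have \<psi>_emb: "\<psi> (emb z) = \<phi> z" for z
    by (simp add: \<psi>_def)
  have \<psi>_edge: "{x, y} \<in> C1 \<longleftrightarrow> \<psi> x \<noteq> \<psi> y" if xy: "{x, y} \<in> edges n" for x y
  proof -
    obtain z i where z: "{x, y} = edge z i" "z \<in> int_box n" "up z i \<in> int_box n"
      using xy unfolding edges_eq by blast
    then have "x = emb z \<and> y = emb (up z i) \<or> x = emb (up z i) \<and> y = emb z"
      by (auto simp: edge_def doubleton_eq_iff)
    then show ?thesis
      using \<phi>[OF z(2,3)] unfolding z(1) by (auto simp: \<psi>_emb)
  qed
  have face_const: "\<psi> x = \<psi> y"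
    if h: "\<And>z. z \<in> int_box n \<Longrightarrow> z v = h \<Longrightarrow> A (emb z) = a"
      and xy: "x \<in> emb ` {z\<in>int_box n. z v = h}" "y \<in> emb ` {z\<in>int_box n. z v = h}" for h a x y
  proof -
    obtain z z' where z: "x = emb z" "z \<in> int_box n" "z v = h" "y = emb z'" "z' \<in> int_box n" "z' v = h"
      using xy by blast
    have "\<phi> z' = \<phi> z"
    proof (rule constant_on_face[of "UNIV - {v}" v n h])
      fix w i assume w: "w \<in> int_box n" "w v = h" "i \<noteq> v" "up w i \<in> int_box n"
      then have "A (emb w) = A (emb (up w i))"
        using h[of w] h[of "up w i"] by (simp add: up_def)
      then have "edge w i \<notin> C1"
        using edge_A[of w i] w by (simp add: C1_def)
      then show "\<phi> (up w i) = \<phi> w"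
        using \<phi>[of w i] w by blast
    qed (use z in auto)
    then show ?thesis
      using z by (simp add: \<psi>_emb)
  qed
  have top_const: "\<psi> x = \<psi> y" if "x \<in> top_face v n \<inter> lattice" "y \<in> top_face v n \<inter> lattice" for x y
    using that A(1) unfolding face_eq by (intro face_const[of "int n" True]) auto
  have bottom_const: "\<psi> x = \<psi> y" if "x \<in> bottom_face v n \<inter> lattice" "y \<in> bottom_face v n \<inter> lattice" for x y
    using that A(2) unfolding face_eq by (intro face_const[of "- int n" False]) auto
  have path_avoiding: "\<exists>xs. top_bottom_path v n xs \<and> path_edges xs \<inter> S = {}" if "S \<subset> C" for S
    using C(2)[OF that] C(1) that by (auto simp: separates_def)
  have "C1 \<subset> C"
    using g not_reach by (auto simp: C1_def)
  then obtain ys where ys: "top_bottom_path v n ys" "path_edges ys \<inter> C1 = {}"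
    using path_avoiding by blast
  have "\<psi> (hd ys) = \<psi> (last ys)"
    by (rule constant_along_path) (use ys \<psi>_edge in \<open>auto simp: top_bottom_path_def\<close>)
  have "C - C1 \<subset> C"
    using f by (auto simp: C1_def)
  then obtain xs where xs: "top_bottom_path v n xs" "path_edges xs \<inter> (C - C1) = {}"
    using path_avoiding by blast
  have "(A (hd xs) \<noteq> \<psi> (hd xs)) = (A (last xs) \<noteq> \<psi> (last xs))"
  proof (rule constant_along_path)
    fix x y assume "{x, y} \<in> path_edges xs"
    then have "{x, y} \<in> edges n" "{x, y} \<in> C1 \<longleftrightarrow> {x, y} \<in> C"
      using xs by (auto simp: top_bottom_path_def C1_def)
    then show "(A x \<noteq> \<psi> x) = (A y \<noteq> \<psi> y)"
      using \<psi>_edge[of x y] A_edge[of x y] by auto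
  qed (use xs in \<open>simp add: top_bottom_path_def\<close>)
  moreover have "A (hd xs)" "\<not> A (last xs)"
    using A xs(1) by (auto simp: top_bottom_path_def)
  moreover have "\<psi> (hd xs) = \<psi> (hd ys)" "\<psi> (last xs) = \<psi> (last ys)"
    using top_const bottom_const xs(1) ys(1) by (auto simp: top_bottom_path_def)
  ultimately show False
    using \<open>\<psi> (hd ys) = \<psi> (last ys)\<close> by auto
qed

lemma segment_nonempty: "f \<in> edges n \<Longrightarrow> segment f \<noteq> {}"
  by (auto simp: segment_def edges_eq edge_def)

section \<open>Cuts and the distance to a fixed edge\<close>

text \<open>
  The path goes straight down a vertical edge of the cube.
\<close>

lemma corner_path:
  fixes v :: "'d::finite"
  obtains xs where "top_bottom_path v n xs"
    "\<And>g w k. g \<in> path_edges xs \<Longrightarrow> w \<in> segment g \<Longrightarrow> k \<noteq> v \<Longrightarrow> w $ k = real n"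
proof -
  define c where "c m = (\<lambda>k. if k = v then int n - int m else int n)" for m :: nat
  define xs where "xs = map (\<lambda>m. emb (c m)) [0..<2 * n + 1]"
  have box: "c m \<in> int_box n" if "m \<le> 2 * n" for m
    using that by (auto simp: c_def int_box_def)
  have path: "\<exists>m. Suc m \<le> 2 * n \<and> g = edge (c (Suc m)) v" if g: "g \<in> path_edges xs" for g
  proof -
    obtain m where m: "Suc m < length xs" "g = {xs ! m, xs ! Suc m}"
      using g unfolding path_edges_def by blast
    have "up (c (Suc m)) v = c m"
      by (auto simp: up_def c_def)
    then have "g = edge (c (Suc m)) v"
      using m by (auto simp: xs_def edge_def nth_append simp del: upt_Suc)
    moreover have "Suc m \<le> 2 * n"
      using m(1) by (simp add: xs_def)
    ultimately show ?thesis
      by blast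
  qed
  have up_c: "up (c (Suc m)) v = c m" for m
    by (auto simp: up_def c_def)
  have "path_edges xs \<subseteq> edges n"
  proof
    fix g assume "g \<in> path_edges xs"
    then obtain m where "Suc m \<le> 2 * n" "g = edge (c (Suc m)) v"
      using path by blast
    then show "g \<in> edges n"
      unfolding edges_eq using box[of m] box[of "Suc m"] up_c[of m] by force
  qed
  moreover have "hd xs = emb (c 0)"
    by (simp add: xs_def hd_map del: upt_Suc)
  moreover have "last xs = emb (c (2 * n))"
    by (simp add: xs_def)
  moreover have "c 0 \<in> {z\<in>int_box n. z v = int n}" "c (2 * n) \<in> {z\<in>int_box n. z v = - int n}"
    using box[of 0] box[of "2 * n"] by (auto simp: c_def)
  ultimately have "top_bottom_path v n xs"
    unfolding top_bottom_path_def face_eq by (auto simp: xs_def)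
  moreover have "w $ k = real n" if g: "g \<in> path_edges xs" and w: "w \<in> segment g" and k: "k \<noteq> v" for g w k
  proof -
    obtain m where m: "g = {emb (c (Suc m)), emb (c m)}"
      using path[OF g] up_c by (auto simp: edge_def)
    obtain s t where "s + t = 1" "w = s *\<^sub>R emb (c (Suc m)) + t *\<^sub>R emb (c m)"
      using w unfolding segment_def m convex_hull_2 by blast
    then have "w $ k = s * real n + t * real n"
      using k by (simp add: c_def)
    also have "\<dots> = (s + t) * real n"
      by (simp only: distrib_right)
    finally show ?thesis
      using \<open>s + t = 1\<close> by simp
  qed
  ultimately show thesis
    by (rule that)
qed

text \<open>
  A separating set meets the path of \<open>corner_path\<close>. Since there is a horizontal direction, the points of
  this path are limits of points outside the cube, so they are at distance at least \<open>r\<close> from \<open>e\<close>.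
\<close>

lemma separates_far_edge:
  fixes v :: "'d::finite"
  assumes card: "CARD('d) \<ge> 2" and sep: "separates v n C" and far: "r \<le> setdist (segment e) (- cube n)"
    and e: "e \<in> edges n"
  shows "\<exists>g\<in>C. r \<le> setdist (segment e) (segment g)"
proof -
  obtain xs where xs: "top_bottom_path v n xs"
      "\<And>g w k. g \<in> path_edges xs \<Longrightarrow> w \<in> segment g \<Longrightarrow> k \<noteq> v \<Longrightarrow> w $ k = real n"
    using corner_path by blast
  then obtain g where g: "g \<in> path_edges xs" "g \<in> C"
    using sep unfolding separates_def by blast
  have "\<exists>k. k \<noteq> v"
  proof (rule ccontr)
    assume "\<not> ?thesis"
    then have "(UNIV :: 'd set) = {v}"
      by auto
    then have "CARD('d) = 1"
      by (metis card_1_singleton_iff One_nat_def)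
    then show False
      using card by simp
  qed
  then obtain k where k: "k \<noteq> v"
    by blast
  have "r \<le> dist a w" if a: "a \<in> segment e" and w: "w \<in> segment g" for a w
  proof (rule field_le_epsilon)
    fix \<epsilon> :: real assume \<epsilon>: "0 < \<epsilon>"
    let ?u = "w + \<epsilon> *\<^sub>R axis k 1"
    have "?u $ k = real n + \<epsilon>"
      using xs(2)[OF g(1) w k] by (simp add: axis_def)
    then have "?u \<in> - cube n"
      using \<epsilon> by (auto simp: cube_def mem_box_cart intro!: exI[of _ k])
    then have "setdist (segment e) (- cube n) \<le> dist a ?u"
      using a by (intro setdist_le_dist)
    also have "\<dots> \<le> dist a w + dist w ?u"
      by (rule dist_triangle)
    also have "dist w ?u = \<epsilon>"
      using \<epsilon> by (simp add: dist_norm norm_axis_1)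
    finally show "r \<le> dist a w + \<epsilon>"
      using far by linarith
  qed
  then have "r \<le> setdist (segment e) (segment g)"
    using e g sep segment_nonempty by (intro le_setdistI) (auto simp: separates_def)
  then show ?thesis
    using g(2) by blast
qed

lemma closed_separator_not_connected: "separates v n C \<Longrightarrow> \<forall>a\<in>C. \<not> y a \<Longrightarrow> \<not> connected_in v n y"
  unfolding separates_def connected_in_def by blast

lemma closed_cut_exists:
  assumes "\<not> connected_in v n y"
  shows "\<exists>C. is_cut v n C \<and> (\<forall>a\<in>C. \<not> y a)"
proof -
  define F where "F = {C. C \<subseteq> {a\<in>edges n. \<not> y a} \<and> separates v n C}"
  have "path_edges xs \<inter> {a\<in>edges n. \<not> y a} \<noteq> {}" if "top_bottom_path v n xs" for xs
    using assms that unfolding connected_in_def top_bottom_path_def by blast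
  then have "{a\<in>edges n. \<not> y a} \<in> F"
    unfolding F_def separates_def by blast
  moreover have "finite F"
    by (rule finite_subset[of _ "Pow (edges n)"]) (auto simp: F_def finite_edges)
  ultimately obtain C where C: "C \<in> F" "\<And>C'. C' \<in> F \<Longrightarrow> C' \<le> C \<Longrightarrow> C = C'"
    using finite_has_minimal[of F] by blast
  have "is_cut v n C"
    unfolding is_cut_def
  proof (intro conjI allI impI)
    show "separates v n C"
      using C(1) by (simp add: F_def)
    fix S' assume "S' \<subset> C"
    then show "\<not> separates v n S'"
      using C unfolding F_def by blast
  qed
  then show ?thesis
    using C(1) unfolding F_def by blast
qed

text \<open>
  The closed edges separate, so they contain a cut; it contains \<open>f\<close>, because opening \<open>f\<close> destroys the
  separation, and it contains a far edge.
\<close>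

lemma pivotal_reaches_far:
  fixes v :: "'d::finite"
  assumes card: "CARD('d) \<ge> 2" and far: "r \<le> setdist (segment e) (- cube n)" and e: "e \<in> edges n"
    and y: "\<not> connected_in v n y" and pivotal: "connected_in v n (y(f := True))"
  shows "\<exists>g\<in>edges n. r \<le> setdist (segment e) (segment g)
    \<and> (f, g) \<in> {(a, b). a \<in> edges n \<and> b \<in> edges n \<and> near a b \<and> \<not> y a \<and> \<not> y b}\<^sup>*"
proof -
  obtain C where C: "is_cut v n C" "\<forall>a\<in>C. \<not> y a"
    using closed_cut_exists[OF y] by blast
  then have sep: "separates v n C"
    by (simp add: is_cut_def)
  have "f \<in> C"
  proof (rule ccontr)
    assume "f \<notin> C"
    then have "\<forall>a\<in>C. \<not> (y(f := True)) a"
      using C(2) by auto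
    then show False
      using closed_separator_not_connected[OF sep] pivotal by blast
  qed
  obtain g where g: "g \<in> C" "r \<le> setdist (segment e) (segment g)"
    using separates_far_edge[OF card sep far e] by blast
  have "{(a, b). a \<in> C \<and> b \<in> C \<and> near a b}\<^sup>*
      \<subseteq> {(a, b). a \<in> edges n \<and> b \<in> edges n \<and> near a b \<and> \<not> y a \<and> \<not> y b}\<^sup>*"
    using C(2) sep by (intro rtrancl_mono) (auto simp: separates_def)
  then show ?thesis
    using cut_near_connected[OF C(1) \<open>f \<in> C\<close> g(1)] g sep by (auto simp: separates_def)
qed

lemma setdist_near:
  assumes "f \<in> edges n" "g \<in> edges n" "near f g" "segment e \<noteq> {}"
  shows "setdist (segment e) (segment g) \<le> setdist (segment e) (segment f) + 2"
proof -
  have 1: "dist x b \<le> 2" if "x \<in> f" "b \<in> segment g" for x b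
  proof -
    have "convex hull g \<subseteq> cball x 2"
      using assms(3) that(1) by (intro hull_minimal) (auto simp: near_def)
    then show ?thesis
      using that(2) by (auto simp: segment_def)
  qed
  have 2: "dist a b \<le> 2" if "a \<in> segment f" "b \<in> segment g" for a b
  proof -
    have "convex hull f \<subseteq> cball b 2"
      using 1 that(2) by (intro hull_minimal) (auto simp: dist_commute)
    then show ?thesis
      using that(1) by (auto simp: segment_def dist_commute)
  qed
  obtain b where b: "b \<in> segment g"
    using segment_nonempty assms(2) by blast
  have "setdist (segment e) (segment g) - 2 \<le> dist u a" if "u \<in> segment e" "a \<in> segment f" for u a
    using setdist_le_dist[OF that(1) b] dist_triangle[of u b a] 2[OF that(2) b] by linarith
  then have "setdist (segment e) (segment g) - 2 \<le> setdist (segment e) (segment f)"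
    using assms(4) segment_nonempty[OF assms(1)] by (intro le_setdistI)
  then show ?thesis
    by simp
qed

lemma near_degree_bounded:
  obtains D where "1 \<le> D" "\<And>n (f :: (real^'d::finite) set). f \<in> edges n \<Longrightarrow> card {g\<in>edges n. near f g} \<le> D"
proof -
  define B where "B = (emb :: _ \<Rightarrow> real^'d) ` int_box 2"
  have finB: "finite B"
    by (simp add: B_def finite_int_box)
  have "0 \<in> B"
    unfolding B_def by (rule image_eqI[of _ _ "\<lambda>_. 0"]) (auto simp: int_box_def vec_eq_iff)
  have diff: "b - a \<in> B" if ab: "a \<in> lattice" "b \<in> lattice" "dist a b \<le> 2" for a b
  proof -
    obtain s t where st: "a = emb s" "b = emb t"
      using ab unfolding lattice_eq by blast
    have "\<bar>t k - s k\<bar> \<le> 2" for k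
    proof -
      have "\<bar>(b - a) $ k\<bar> \<le> norm (b - a)"
        by (rule component_le_norm_cart)
      also have "\<dots> \<le> 2"
        using ab(3) by (simp add: dist_norm norm_minus_commute)
      finally show ?thesis
        using st by simp
    qed
    then have "(\<lambda>k. t k - s k) \<in> int_box 2" "b - a = emb (\<lambda>k. t k - s k)"
      by (auto simp: int_box_def st vec_eq_iff)
    then show ?thesis
      unfolding B_def by blast
  qed
  have deg: "card {g\<in>edges n. near f g} \<le> card (B \<times> B)" if f: "f \<in> edges n" for n and f :: "(real^'d) set"
  proof -
    obtain x where x: "x \<in> f" "x \<in> lattice"
      using f unfolding edges_def lattice_edges_def by blast
    have "g \<in> (\<lambda>(s, t). {x + s, x + t}) ` (B \<times> B)" if g: "g \<in> edges n" "near f g" for g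
    proof -
      obtain a b where ab: "g = {a, b}" "a \<in> lattice" "b \<in> lattice"
        using g(1) unfolding edges_def lattice_edges_def by blast
      then have "a - x \<in> B" "b - x \<in> B"
        using g(2) x by (auto simp: near_def intro!: diff)
      then show ?thesis
        using ab(1) by (intro image_eqI[of _ _ "(a - x, b - x)"]) auto
    qed
    then have "{g\<in>edges n. near f g} \<subseteq> (\<lambda>(s, t). {x + s, x + t}) ` (B \<times> B)"
      by blast
    then show ?thesis
      using surj_card_le[OF finite_cartesian_product[OF finB finB]] by blast
  qed
  have "1 \<le> card (B \<times> B)"
    using finB \<open>0 \<in> B\<close> by (auto simp: Suc_le_eq card_gt_0_iff)
  then show thesis
    using that deg by blast
qed

text \<open>
  A separating set whose edges are closed in \<open>y\<close> and not nearby is the same as a separating set that is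
  still closed once all nearby edges are open, and every separating set contains a cut.
\<close>

lemma far_cut_iff:
  assumes "e \<in> edges n"
  shows "(\<exists>C\<in>closed_cuts v n y. r \<le> setdist (segment e) (support C)) \<longleftrightarrow>
    \<not> connected_in v n (\<lambda>f. f \<in> {f\<in>edges n. setdist (segment e) (segment f) < r} \<or> y f)"
proof
  assume "\<exists>C\<in>closed_cuts v n y. r \<le> setdist (segment e) (support C)"
  then obtain C where C: "is_cut v n C" "\<forall>a\<in>C. \<not> y a" "r \<le> setdist (segment e) (support C)"
    by (auto simp: closed_cuts_def)
  have sep: "separates v n C"
    using C(1) by (simp add: is_cut_def)
  have "r \<le> setdist (segment e) (segment a)" if "a \<in> C" for a
  proof -
    have "setdist (segment e) (support C) \<le> setdist (segment e) (segment a)"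
      using that sep segment_nonempty by (intro setdist_subset_right) (auto simp: support_def separates_def)
    then show ?thesis
      using C(3) by linarith
  qed
  then show "\<not> connected_in v n (\<lambda>f. f \<in> {f\<in>edges n. setdist (segment e) (segment f) < r} \<or> y f)"
    using C(2) by (intro closed_separator_not_connected[OF sep]) fastforce
next
  assume "\<not> connected_in v n (\<lambda>f. f \<in> {f\<in>edges n. setdist (segment e) (segment f) < r} \<or> y f)"
  then obtain C where C: "is_cut v n C" "\<And>a. a \<in> C \<Longrightarrow> \<not> y a"
      "\<And>a. a \<in> C \<Longrightarrow> a \<notin> {f\<in>edges n. setdist (segment e) (segment f) < r}"
    using closed_cut_exists by blast
  then have sub: "C \<subseteq> edges n"
    by (simp add: is_cut_def separates_def)
  obtain xs where "top_bottom_path v n xs"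
    by (rule corner_path[of v n]) (rule that)
  then have "C \<noteq> {}"
    using C(1) unfolding is_cut_def separates_def by blast
  then obtain g where "g \<in> C" "segment g \<noteq> {}"
    using sub segment_nonempty by blast
  then have "support C \<noteq> {}"
    unfolding support_def by blast
  moreover have "r \<le> dist a b" if a: "a \<in> segment e" and b: "b \<in> support C" for a b
  proof -
    obtain g where g: "g \<in> C" "b \<in> segment g"
      using b by (auto simp: support_def)
    then have "r \<le> setdist (segment e) (segment g)"
      using C(3)[OF g(1)] sub by auto
    also have "\<dots> \<le> dist a b"
      using a g(2) by (rule setdist_le_dist)
    finally show ?thesis .
  qed
  ultimately have "r \<le> setdist (segment e) (support C)"
    using segment_nonempty[OF assms] by (intro le_setdistI)
  then show "\<exists>C\<in>closed_cuts v n y. r \<le> setdist (segment e) (support C)"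
    using C(1,2) unfolding closed_cuts_def by blast
qed

section \<open>The constants\<close>

text \<open>
  Since \<open>K \<le> N\<^sup>2\<close> and \<open>M \<le> N\<^sup>2\<close>, the factor in front of \<open>q ^ l\<close> is at most \<open>N ^ 6\<close>. As \<open>q \<le> exp (- 1)\<close>, the
  choice \<open>l \<ge> 5 * c * L\<close> makes the product at most \<open>exp (- c * L - 1)\<close>, and so is \<open>exp (- K)\<close>. The two
  terms together are below \<open>exp (- c * L)\<close> because \<open>exp 1 \<ge> 2\<close>.
\<close>

lemma numerical_bounds:
  fixes N c q :: real and M :: nat
  defines "L \<equiv> ln N"
  defines "K \<equiv> nat \<lceil>c * L + 1\<rceil>" and "l \<equiv> nat \<lceil>5 * c * L\<rceil>"
  assumes N: "0 < N" and c: "2 \<le> c" and L: "4 + c < L" and M: "real M \<le> N\<^sup>2" and q: "0 \<le> q" "q \<le> 1 / 3"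
  shows "1 \<le> l" "2 * real l * real K < 25 * c\<^sup>2 * L\<^sup>2"
    "(real K)\<^sup>2 * real M * q ^ l + exp (- real K) \<le> 1 / N powr c"
proof -
  have L6: "6 < L"
    using c L by simp
  have cL: "12 \<le> c * L"
    using mult_mono[of 2 c 6 L] c L6 by simp
  have K: "c * L + 1 \<le> real K" "real K \<le> 2 * (c * L)"
    using cL by (simp_all add: K_def) linarith+
  have l: "5 * (c * L) \<le> real l" "real l \<le> 6 * (c * L)"
    using cL by (simp_all add: l_def mult.assoc) linarith+
  show "1 \<le> l"
    using l(1) cL by linarith
  have "2 * real l * real K \<le> 2 * (6 * (c * L)) * (2 * (c * L))"
    using l(2) K(2) cL by (intro mult_mono) auto
  also have "\<dots> = 24 * (c * L)\<^sup>2"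
    by (simp add: power2_eq_square)
  also have "\<dots> < 25 * (c * L)\<^sup>2"
    using zero_less_power[of "c * L" 2] cL by linarith
  finally show "2 * real l * real K < 25 * c\<^sup>2 * L\<^sup>2"
    by (simp add: power_mult_distrib mult.assoc)
  have exp_L: "exp (k * L) = N powr k" for k
    using N by (simp add: L_def powr_def)
  have "real K \<le> 2 * L\<^sup>2"
  proof -
    have "c * L \<le> L * L"
      using L L6 by (intro mult_right_mono) auto
    then show ?thesis
      using K(2) by (simp add: power2_eq_square)
  qed
  also have "\<dots> \<le> (L\<^sup>2 / 2)\<^sup>2"
  proof -
    have "6 * 6 \<le> L * L"
      using L6 by (intro mult_mono) auto
    then have "8 * L\<^sup>2 \<le> L\<^sup>2 * L\<^sup>2"
      by (intro mult_right_mono) (auto simp: power2_eq_square)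
    then show ?thesis
      by (simp add: power_divide power2_eq_square[of "L\<^sup>2"])
  qed
  also have "\<dots> \<le> (exp L)\<^sup>2"
    using exp_lower_Taylor_quadratic[of L] L6 by (intro power_mono) auto
  finally have "(real K)\<^sup>2 \<le> ((exp L)\<^sup>2)\<^sup>2"
    by (intro power_mono) auto
  moreover have "real M \<le> (exp L)\<^sup>2"
    using M N by (simp add: L_def)
  ultimately have "(real K)\<^sup>2 * real M \<le> ((exp L)\<^sup>2)\<^sup>2 * (exp L)\<^sup>2"
    by (intro mult_mono) auto
  also have "\<dots> = exp (6 * L)"
    by (simp add: exp_of_nat_mult[of 6 L, simplified] power_mult[symmetric] power_add[symmetric])
  finally have poly: "(real K)\<^sup>2 * real M \<le> exp (6 * L)" .
  have "1 / 3 \<le> exp (- 1 :: real)"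
    using exp_le by (simp add: exp_minus field_simps)
  then have "q ^ l \<le> exp (- 1) ^ l"
    using q by (intro power_mono) auto
  also have "\<dots> = exp (- real l)"
    by (simp add: exp_of_nat_mult[symmetric])
  also have "\<dots> \<le> exp (- 5 * (c * L))"
    using l(1) by simp
  finally have "(real K)\<^sup>2 * real M * q ^ l \<le> exp (6 * L) * exp (- 5 * (c * L))"
    using poly q by (intro mult_mono) auto
  also have "\<dots> = exp (6 * L - 5 * (c * L))"
    by (simp add: exp_add[symmetric])
  also have "\<dots> \<le> exp (- (c * L) - 1)"
  proof -
    have "2 * L \<le> c * L"
      using c L6 by (intro mult_right_mono) auto
    then show ?thesis
      unfolding exp_le_cancel_iff using L6 by linarith
  qed
  finally have "(real K)\<^sup>2 * real M * q ^ l + exp (- real K) \<le> exp (- (c * L) - 1) + exp (- (c * L) - 1)"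
    using K(1) by (intro add_mono) auto
  also have "\<dots> = 2 * exp (- 1) * exp (- (c * L))"
    by (simp add: exp_diff exp_minus field_simps)
  also have "\<dots> \<le> 1 * exp (- (c * L))"
    using exp_ge_add_one_self[of 1] by (intro mult_right_mono) (auto simp: exp_minus field_simps)
  also have "\<dots> = 1 / N powr c"
    by (simp add: exp_L[symmetric] exp_minus inverse_eq_divide)
  finally show "(real K)\<^sup>2 * real M * q ^ l + exp (- real K) \<le> 1 / N powr c" .
qed

theorem theorem1p3:
  assumes "CARD('d::finite) \<ge> 2"
  shows "\<exists>p' \<kappa> :: real. p' < 1 \<and> \<kappa> > 0 \<and>
    (\<forall>(v :: 'd) (n :: nat) (p :: real) (c :: real) (e :: (real^'d) set)
        (\<mu> :: ('d config \<times> 'd config) pmf).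
      let N = real (cube_size TYPE('d) n); d = real CARD('d);
          r = \<kappa> * c\<^sup>2 * (ln N)\<^sup>2
      in
        0 < p \<longrightarrow> p' \<le> p \<longrightarrow> p < 1 \<longrightarrow> c \<ge> 2 \<longrightarrow> n \<ge> 1 \<longrightarrow>
        ln N > 4 + c + 2 * d * c\<^sup>2 + 12 * (2 * \<kappa> * d) ^ CARD('d) \<longrightarrow>
        e \<in> edges n \<longrightarrow> setdist (segment e) (- cube n) \<ge> r \<longrightarrow>
        equilibrium v n p \<mu> \<longrightarrow>
        \<P>((x, y) in \<mu>. \<exists>C\<in>closed_cuts v n y. setdist (segment e) (support C) \<ge> r) > 0 \<longrightarrow>
        \<P>((x, y) in \<mu>. e \<in> interface n x y
            \<bar> \<exists>C\<in>closed_cuts v n y. setdist (segment e) (support C) \<ge> r)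
          \<le> 1 / N powr c)"
proof -
  obtain D where D: "1 \<le> D" "\<And>n (f :: (real^'d) set). f \<in> edges n \<Longrightarrow> card {g\<in>edges n. near f g} \<le> D"
    using near_degree_bounded by blast
  \<comment> \<open>With this choice \<open>2 * D * (1 - p)\<close> is at most \<open>1 / 3\<close>, as \<open>numerical_bounds\<close> requires.\<close>
  define p' where "p' = 1 - 1 / (6 * real D)"
  have main: "\<P>((x, y) in \<mu>. e \<in> interface n x y \<bar> \<exists>C\<in>closed_cuts v n y. setdist (segment e) (support C) \<ge> r)
      \<le> 1 / N powr c"
    if N_def: "N = real (cube_size TYPE('d) n)" and r_def: "r = 25 * c\<^sup>2 * (ln N)\<^sup>2"
      and p: "0 < p" "p' \<le> p" "p < 1" and c: "2 \<le> c" and n: "1 \<le> n"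
      and N_large: "4 + c < ln N" and e: "e \<in> edges n" and inside: "r \<le> setdist (segment e) (- cube n)"
      and eq: "equilibrium v n p \<mu>"
      and pos: "0 < \<P>((x, y) in \<mu>. \<exists>C\<in>closed_cuts v n y. setdist (segment e) (support C) \<ge> r)"
    for v :: 'd and n and p c r N :: real and e :: "(real^'d) set" and \<mu> :: "('d config \<times> 'd config) pmf"
  proof -
    define \<delta> where "\<delta> f = setdist (segment e) (segment f)" for f
    interpret localized_dynamics "edges n" "connected_in v n" p near \<delta> r D
    proof
      show "connected_in v n y" if "connected_in v n x" "\<And>e. e \<in> edges n \<Longrightarrow> x e \<Longrightarrow> y e" for x y
        using that unfolding connected_in_def top_bottom_path_def by blast
      show "\<delta> g \<le> \<delta> f + 2" if "f \<in> edges n" "g \<in> edges n" "near f g" for f g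
        unfolding \<delta>_def using that segment_nonempty[OF e] by (rule setdist_near)
      show "\<exists>g\<in>edges n. r \<le> \<delta> g \<and> (f, g) \<in> {(a, b). a \<in> edges n \<and> b \<in> edges n \<and> near a b \<and> \<not> y a \<and> \<not> y b}\<^sup>*"
        if "\<not> connected_in v n y" "connected_in v n (y(f := True))" for y f
        unfolding \<delta>_def using pivotal_reaches_far[OF assms inside e that] .
    qed (use finite_edges edges_nonempty[OF n] p D in auto)
    have far_iff: "(\<exists>C\<in>closed_cuts v n y. r \<le> setdist (segment e) (support C)) \<longleftrightarrow> far_blocked y" for y
      unfolding far_blocked_def nearby_def \<delta>_def by (rule far_cut_iff[OF e])
    have supp: "snd ` set_pmf \<mu> \<subseteq> blocked_configs"
    proof (rule image_subsetI)
      fix s assume "s \<in> set_pmf \<mu>"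
      then have "s \<in> states v n"
        using eq by (auto simp: equilibrium_def)
      then show "snd s \<in> blocked_configs"
        by (cases s) (simp add: states_def blocked_configs_def configs_def)
    qed
    have "kernel v n p = (\<lambda>(x, y). map_pmf (\<lambda>z. (x(fst z := snd z), step z y)) noise)"
      by (auto simp: fun_eq_iff kernel_def noise_def update_def open_edge_def step_def case_prod_unfold)
    then have stationary: "bind_pmf \<mu> (\<lambda>(x, y). map_pmf (\<lambda>z. (x(fst z := snd z), step z y)) noise) = \<mu>"
      using eq by (simp add: equilibrium_def)
    have N_pos: "0 < N"
      using N_large c by (cases "N = 0") (auto simp: N_def)
    have card_le: "real (card (edges n :: (real^'d) set set)) \<le> N\<^sup>2"
      unfolding N_def using card_edges_le[where 'd = 'd, of n] by (metis of_nat_le_iff of_nat_power)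
    have q: "0 \<le> 2 * real D * (1 - p)" "2 * real D * (1 - p) \<le> 1 / 3"
    proof -
      have "2 * real D * (1 - p) \<le> 2 * real D * (1 / (6 * real D))"
        using p(2) by (intro mult_left_mono) (auto simp: p'_def)
      then show "2 * real D * (1 - p) \<le> 1 / 3"
        using D(1) by simp
    qed (use p in simp)
    define K where "K = nat \<lceil>c * ln N + 1\<rceil>"
    define l where "l = nat \<lceil>5 * c * ln N\<rceil>"
    note bounds = numerical_bounds[OF N_pos c N_large card_le q, folded K_def l_def]
    have "0 < r"
      using c N_large by (simp add: r_def)
    have "\<delta> e = 0"
      using segment_nonempty[OF e] by (auto simp: \<delta>_def intro: setdist_eq_0I)
    have "measure \<mu> {s. fst s e \<noteq> snd s e \<and> far_blocked (snd s)}
        \<le> ((real K)\<^sup>2 * real (card (edges n :: (real^'d) set set)) * (2 * real D * (1 - p)) ^ l + exp (- real K))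
          * measure \<mu> {s. far_blocked (snd s)}"
      by (rule disagreement_far_from_blocking[OF supp stationary e \<open>\<delta> e = 0\<close> \<open>0 < r\<close>])
        (use bounds(1,2) in \<open>simp_all add: r_def\<close>)
    also have "\<dots> \<le> 1 / N powr c * measure \<mu> {s. far_blocked (snd s)}"
      using bounds(3) by (intro mult_right_mono) auto
    finally have "measure \<mu> {s. fst s e \<noteq> snd s e \<and> far_blocked (snd s)} \<le> 1 / N powr c * measure \<mu> {s. far_blocked (snd s)}" .
    then show ?thesis
      using pos e
      by (simp add: cond_prob_def far_iff case_prod_unfold interface_def pos_divide_le_eq)
  qed
  have "p' < 1"
    using D(1) by (simp add: p'_def)
  moreover have "4 + c < L" if "4 + c + 2 * real CARD('d) * c\<^sup>2 + 12 * (2 * 25 * real CARD('d)) ^ CARD('d) < L" for c L :: real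
  proof -
    have "0 \<le> 2 * real CARD('d) * c\<^sup>2 + 12 * (2 * 25 * real CARD('d)) ^ CARD('d)"
      by simp
    with that show ?thesis
      by linarith
  qed
  ultimately show ?thesis
    unfolding Let_def
    by (intro exI[of _ p'] exI[of _ 25] conjI allI impI main[OF refl refl]) auto
qed

end
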